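(* Let $M\subset LG(2,4)\cong\mathcal{Q}$ be a connected hyperbolic surface. Then $M$ is 2-isotropic if and only if $M$ is an open subset of an indefinite sphere.
   Context: Let $V=\mathbb{R}^5$ with coordinates $z=(z_0,\dots,z_4)$ and the symmetric bilinear form $\langle z,w\rangle=-z_0w_4-z_4w_0+z_1w_3+z_3w_1-2z_2w_2$, of signature $(2,3)$. Let $\mathcal{Q}=\{[z]\in\mathbb{P}V:\langle z,z\rangle=0\}$. The Lagrangian Grassmannian $LG(2,4)$ (2-dimensional isotropic subspaces of $\mathbb{R}^4$ with its standard symplectic form) is identified with $\mathcal{Q}$ by the Plücker embedding; the subspace $\mathrm{span}\{e_1+re_3+se_4,\ e_2+se_3+te_4\}$ corresponds to $[1,r,s,t,rt-s^2]$. The form $\langle\cdot,\cdot\rangle$ induces on $\mathcal{Q}$ a Lorentzian conformal structure $[\mu]$, represented in the coordinates $(r,s,t)$ by $\mu=dr\,dt-ds^2$. A surface $M\subset\mathcal{Q}$ means a smooth embedded surface; it is hyperbolic if every tangent plane contains exactly two distinct null lines of $[\mu]$. Second order type: let $M$ be hyperbolic. Near any point choose a smooth lift $\mathbf{x}:M\to V\setminus\{0\}$ of the inclusion $M\subset\mathbb{P}V$, linearly independent null tangent vector fields $N_1,N_2$, and a $V$-valued function $\mathbf{n}$ with $\langle\mathbf n,\mathbf n\rangle=-2$, $\langle\mathbf n,\mathbf x\rangle=0$, $\langle \mathbf n,d\mathbf x\rangle=0$. Put $\ell_i=\langle N_i(N_i\mathbf x),\mathbf n\rangle$, $i=1,2$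 (the components of the trace-free second fundamental form). The vanishing of $\ell_1$, $\ell_2$ does not depend on the choices. $M$ is 2-isotropic if $\ell_1=\ell_2=0$ everywhere (equivalently, $M$ is doubly-ruled by null geodesics). For $[z]\in\mathbb{P}V$, the sphere $\mathcal{S}_{[z]}$ is $\mathbb{P}(z^\perp)\cap\mathcal{Q}$; it is indefinite if $\langle z,z\rangle<0$. *)

theory Defs
  imports "HOL-Analysis.Analysis"
begin

section \<open>The quadric and the Lagrangian Grassmannian\<close>

text \<open>The indices of \<^typ>\<open>real^5\<close> are residues mod 5, so \<open>$ 0, \<dots>, $ 4\<close> are its five
  coordinates.\<close>

definition bil :: "real^5 \<Rightarrow> real^5 \<Rightarrow> real" where
  "bil z w = - (z$0 * w$4) - z$4 * w$0 + z$1 * w$3 + z$3 * w$1 - 2 * (z$2 * w$2)"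

definition ppoint :: "real^5 \<Rightarrow> (real^5) set" where
  "ppoint z = span {z}"

definition PV :: "(real^5) set set" where
  "PV = ppoint ` (- {0})"

definition PV_top :: "(real^5) set topology" where
  "PV_top = topology (\<lambda>U. U \<subseteq> PV \<and> open {z. z \<noteq> 0 \<and> ppoint z \<in> U})"

definition quadric :: "(real^5) set set" where
  "quadric = ppoint ` {z. z \<noteq> 0 \<and> bil z z = 0}"

definition sphere_of :: "real^5 \<Rightarrow> (real^5) set set" where
  "sphere_of z = ppoint ` {w. w \<noteq> 0 \<and> bil z w = 0} \<inter> quadric"

definition indefinite_sphere :: "(real^5) set set \<Rightarrow> bool" where
  "indefinite_sphere S \<longleftrightarrow> (\<exists>z. z \<noteq> 0 \<and> bil z z < 0 \<and> S = sphere_of z)"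

definition omega :: "real^4 \<Rightarrow> real^4 \<Rightarrow> real" where
  "omega a b = a$1 * b$3 - a$3 * b$1 + a$2 * b$4 - a$4 * b$2"

definition LG24 :: "(real^4) set set" where
  "LG24 = {L. subspace L \<and> dim L = 2 \<and> (\<forall>a\<in>L. \<forall>b\<in>L. omega a b = 0)}"

text \<open>With \<open>p\<^sub>i\<^sub>j = a\<^sub>i b\<^sub>j - a\<^sub>j b\<^sub>i\<close>, these are the coordinates
  \<open>(p\<^sub>1\<^sub>2, -p\<^sub>2\<^sub>3, p\<^sub>1\<^sub>3, p\<^sub>1\<^sub>4, p\<^sub>3\<^sub>4)\<close>; on Lagrangian planes \<open>p\<^sub>2\<^sub>4 = -p\<^sub>1\<^sub>3\<close>, so no Pluecker
  coordinate is lost.\<close>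

definition plucker_vec :: "real^4 \<Rightarrow> real^4 \<Rightarrow> real^5" where
  "plucker_vec a b = (\<chi> i.
     if i = 0 then a$1 * b$2 - a$2 * b$1
     else if i = 1 then - (a$2 * b$3 - a$3 * b$2)
     else if i = 2 then a$1 * b$3 - a$3 * b$1
     else if i = 3 then a$1 * b$4 - a$4 * b$1
     else a$3 * b$4 - a$4 * b$3)"

text \<open>The span over all pairs from a plane \<open>L\<close> is the line through \<^term>\<open>plucker_vec a b\<close> for
  any basis \<open>a\<close>, \<open>b\<close> of \<open>L\<close>; see \<open>plucker_span\<close> below.\<close>

definition plucker :: "(real^4) set \<Rightarrow> (real^5) set" where
  "plucker L = span {plucker_vec a b | a b. a \<in> L \<and> b \<in> L}"


section \<open>Smooth surfaces in the quadric\<close>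

text \<open>For open \<open>S\<close> this is the usual \<open>C\<^sup>k\<close> condition, phrased through directional derivatives.\<close>

primrec Ck_on :: "nat \<Rightarrow> ('a::euclidean_space \<Rightarrow> 'b::real_normed_vector) \<Rightarrow> 'a set \<Rightarrow> bool" where
  "Ck_on 0 f S \<longleftrightarrow> continuous_on S f"
| "Ck_on (Suc k) f S \<longleftrightarrow> (\<forall>u\<in>S. f differentiable (at u)) \<and>
     (\<forall>v. Ck_on k (\<lambda>u. frechet_derivative f (at u) v) S)"

definition smooth_on :: "('a::euclidean_space) set \<Rightarrow> ('a \<Rightarrow> 'b::real_normed_vector) \<Rightarrow> bool" where
  "smooth_on S f \<longleftrightarrow> (\<forall>k. Ck_on k f S)"

text \<open>A local parametrization of \<open>M\<close> is given together with a lift \<open>x\<close> to \<open>V - {0}\<close>.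
  Since the differential of \<^const>\<open>ppoint\<close> at \<open>z\<close> has kernel \<open>span {z}\<close>, the third conjunct says that
  \<open>ppoint \<circ> x\<close> is an immersion.\<close>

definition local_param :: "(real^5) set set \<Rightarrow> (real^2) set \<Rightarrow> (real^2 \<Rightarrow> real^5) \<Rightarrow> bool" where
  "local_param M D x \<longleftrightarrow>
     open D \<and> smooth_on D x \<and>
     (\<forall>u\<in>D. x u \<noteq> 0) \<and>
     (\<forall>u\<in>D. \<forall>v. v \<noteq> 0 \<longrightarrow> frechet_derivative x (at u) v \<notin> span {x u}) \<and>
     openin (subtopology PV_top M) ((ppoint \<circ> x) ` D) \<and>
     embedding_map (top_of_set D) PV_top (ppoint \<circ> x)"

definition surface :: "(real^5) set set \<Rightarrow> bool" where
  "surface M \<longleftrightarrow> M \<subseteq> quadric \<and>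
     (\<forall>p\<in>M. \<exists>D x. local_param M D x \<and> p \<in> (ppoint \<circ> x) ` D)"

text \<open>The pullback along \<open>x\<close> of the representative of the conformal structure of the quadric that
  is determined by the lift \<open>x\<close>.\<close>

definition induced_form :: "(real^2 \<Rightarrow> real^5) \<Rightarrow> real^2 \<Rightarrow> real^2 \<Rightarrow> real^2 \<Rightarrow> real" where
  "induced_form x u v w = bil (frechet_derivative x (at u) v) (frechet_derivative x (at u) w)"

text \<open>The tangent plane of \<open>M\<close> at \<open>ppoint (x u)\<close> is identified with \<^typ>\<open>real^2\<close> by the
  differential of \<open>ppoint \<circ> x\<close> at \<open>u\<close>.\<close>

definition null_lines :: "(real^2 \<Rightarrow> real^5) \<Rightarrow> real^2 \<Rightarrow> (real^2) set set" where
  "null_lines x u = {span {v} | v. v \<noteq> 0 \<and> induced_form x u v v = 0}"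

definition hyperbolic :: "(real^5) set set \<Rightarrow> bool" where
  "hyperbolic M \<longleftrightarrow>
     (\<forall>D x. local_param M D x \<longrightarrow> (\<forall>u\<in>D. card (null_lines x u) = 2))"


section \<open>Second order type\<close>

definition along :: "(real^2 \<Rightarrow> real^2) \<Rightarrow> (real^2 \<Rightarrow> real^5) \<Rightarrow> real^2 \<Rightarrow> real^5" where
  "along N f u = frechet_derivative f (at u) (N u)"

definition null_frame :: "(real^2) set \<Rightarrow> (real^2 \<Rightarrow> real^5) \<Rightarrow>
    (real^2 \<Rightarrow> real^2) \<Rightarrow> (real^2 \<Rightarrow> real^2) \<Rightarrow> bool" where
  "null_frame D x N1 N2 \<longleftrightarrow> smooth_on D N1 \<and> smooth_on D N2 \<and>
     (\<forall>u\<in>D. N1 u \<noteq> N2 u \<and> independent {N1 u, N2 u} \<and>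
        induced_form x u (N1 u) (N1 u) = 0 \<and> induced_form x u (N2 u) (N2 u) = 0)"

definition normal_field :: "(real^2) set \<Rightarrow> (real^2 \<Rightarrow> real^5) \<Rightarrow> (real^2 \<Rightarrow> real^5) \<Rightarrow> bool" where
  "normal_field D x n \<longleftrightarrow> smooth_on D n \<and>
     (\<forall>u\<in>D. bil (n u) (n u) = -2 \<and> bil (n u) (x u) = 0 \<and>
        (\<forall>v. bil (n u) (frechet_derivative x (at u) v) = 0))"

definition ell :: "(real^2 \<Rightarrow> real^5) \<Rightarrow> (real^2 \<Rightarrow> real^2) \<Rightarrow> (real^2 \<Rightarrow> real^5) \<Rightarrow> real^2 \<Rightarrow> real" where
  "ell x N n u = bil (along N (along N x) u) (n u)"

text \<open>On a hyperbolic surface such data exist near every point, and whether \<^const>\<open>ell\<close> vanishes at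
  a point does not depend on them, so quantifying the data existentially is no restriction.\<close>

definition two_isotropic :: "(real^5) set set \<Rightarrow> bool" where
  "two_isotropic M \<longleftrightarrow> (\<forall>p\<in>M. \<exists>D x N1 N2 n.
     local_param M D x \<and> p \<in> (ppoint \<circ> x) ` D \<and> null_frame D x N1 N2 \<and> normal_field D x n \<and>
     (\<forall>u\<in>D. ell x N1 n u = 0 \<and> ell x N2 n u = 0))"


section \<open>Consistency facts\<close>

lemma istopology_PV: "istopology (\<lambda>U. U \<subseteq> PV \<and> open {z. z \<noteq> 0 \<and> ppoint z \<in> U})"
  unfolding istopology_def
proof (intro conjI allI impI; (elim conjE)?)
  fix S T assume "open {z. z \<noteq> 0 \<and> ppoint z \<in> S}" "open {z. z \<noteq> 0 \<and> ppoint z \<in> T}"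
  then have "open ({z. z \<noteq> 0 \<and> ppoint z \<in> S} \<inter> {z. z \<noteq> 0 \<and> ppoint z \<in> T})" by blast
  moreover have "{z. z \<noteq> 0 \<and> ppoint z \<in> S} \<inter> {z. z \<noteq> 0 \<and> ppoint z \<in> T} 
    = {z. z \<noteq> 0 \<and> ppoint z \<in> S \<inter> T}" by blast
  ultimately show "open {z. z \<noteq> 0 \<and> ppoint z \<in> S \<inter> T}" by simp
next
  fix K assume K: "\<forall>U\<in>K. U \<subseteq> PV \<and> open {z. z \<noteq> 0 \<and> ppoint z \<in> U}"
  have "{z. z \<noteq> 0 \<and> ppoint z \<in> \<Union>K} = (\<Union>U\<in>K. {z. z \<noteq> 0 \<and> ppoint z \<in> U})" by blast
  with K show "open {z. z \<noteq> 0 \<and> ppoint z \<in> \<Union>K}" by auto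
qed auto

lemma openin_PV_top:
  "openin PV_top U \<longleftrightarrow> U \<subseteq> PV \<and> open {z. z \<noteq> 0 \<and> ppoint z \<in> U}"
  unfolding PV_top_def by (simp add: topology_inverse'[OF istopology_PV])

lemma topspace_PV_top: "topspace PV_top = PV"
proof -
  have "{z. z \<noteq> 0 \<and> ppoint z \<in> PV} = - {0}" by (auto simp: PV_def)
  then have "openin PV_top PV" by (simp add: openin_PV_top open_Compl)
  then show ?thesis by (meson openin_PV_top openin_subset openin_topspace subset_antisym)
qed

lemma quotient_map_ppoint: "quotient_map (top_of_set (- {0})) PV_top ppoint"
  unfolding quotient_map_def
proof (intro conjI allI impI)
  show "ppoint ` topspace (top_of_set (- {0})) = topspace PV_top"
    by (simp add: topspace_PV_top PV_def)
  fix U assume U: "U \<subseteq> topspace PV_top"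
  have "{z. z \<noteq> 0 \<and> ppoint z \<in> U} = {z. z \<in> - {0} \<and> ppoint z \<in> U}" by auto
  with U show "openin (top_of_set (- {0})) {z \<in> topspace (top_of_set (- {0})). ppoint z \<in> U} = openin PV_top U"
    by (simp add: openin_PV_top topspace_PV_top openin_open_eq open_Compl)
qed

lemma five_cases: "(i::5) = 0 \<or> i = 1 \<or> i = 2 \<or> i = 3 \<or> i = 4"
proof (induct i)
  case (of_int z)
  then have "z = 0 \<or> z = 1 \<or> z = 2 \<or> z = 3 \<or> z = 4" by fastforce
  then show ?case by auto
qed

lemma vec5_eq_iff:
  "(z::real^5) = w \<longleftrightarrow> z$0 = w$0 \<and> z$1 = w$1 \<and> z$2 = w$2 \<and> z$3 = w$3 \<and> z$4 = w$4"
  unfolding vec_eq_iff by (metis five_cases)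

lemma vec4_eq_iff:
  "(z::real^4) = w \<longleftrightarrow> z$1 = w$1 \<and> z$2 = w$2 \<and> z$3 = w$3 \<and> z$4 = w$4"
  unfolding vec_eq_iff forall_4 ..

lemma plucker_vec_nth [simp]:
  "plucker_vec a b $ 0 = a$1 * b$2 - a$2 * b$1"
  "plucker_vec a b $ 1 = a$3 * b$2 - a$2 * b$3"
  "plucker_vec a b $ 2 = a$1 * b$3 - a$3 * b$1"
  "plucker_vec a b $ 3 = a$1 * b$4 - a$4 * b$1"
  "plucker_vec a b $ 4 = a$3 * b$4 - a$4 * b$3"
  by (simp_all add: plucker_vec_def)

lemma span_pair: "(v::real^4) \<in> span {a, b} \<longleftrightarrow> (\<exists>c d. v = c *\<^sub>R a + d *\<^sub>R b)"
  by (simp add: span_breakdown_eq) (metis add.commute diff_eq_eq)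

lemma plucker_span: "plucker (span {a, b}) = ppoint (plucker_vec a b)"
proof -
  have *: "plucker_vec v w \<in> span {plucker_vec a b}" if "v \<in> span {a, b}" "w \<in> span {a, b}" for v w
  proof -
    from that obtain c d c' d' where vw: "v = c *\<^sub>R a + d *\<^sub>R b" "w = c' *\<^sub>R a + d' *\<^sub>R b"
      unfolding span_pair by blast
    have "plucker_vec v w = (c * d' - d * c') *\<^sub>R plucker_vec a b"
      by (simp add: vw vec5_eq_iff algebra_simps)
    then show ?thesis by (simp add: span_base span_scale)
  qed
  have ab: "a \<in> span {a, b}" "b \<in> span {a, b}" by (simp_all add: span_base)
  show ?thesis
    unfolding plucker_def ppoint_def
  proof (rule subset_antisym)
    show "span {plucker_vec v w | v w. v \<in> span {a, b} \<and> w \<in> span {a, b}} \<subseteq> span {plucker_vec a b}"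
      by (rule span_minimal) (use * in auto)
    show "span {plucker_vec a b} \<subseteq> span {plucker_vec v w | v w. v \<in> span {a, b} \<and> w \<in> span {a, b}}"
      by (rule span_mono) (use ab in blast)
  qed
qed

lemma plucker_chart:
  fixes e1 e2 e3 e4 :: "real^4"
  defines "e1 \<equiv> axis 1 1" and "e2 \<equiv> axis 2 1" and "e3 \<equiv> axis 3 1" and "e4 \<equiv> axis 4 1"
  shows "plucker (span {e1 + r *\<^sub>R e3 + s *\<^sub>R e4, e2 + s *\<^sub>R e3 + t *\<^sub>R e4})
    = ppoint (\<chi> i. if i = 0 then 1 else if i = 1 then r else if i = 2 then s
                 else if i = 3 then t else r * t - s^2)"
  unfolding plucker_span
  by (rule arg_cong[where f = ppoint])
     (simp add: vec5_eq_iff e1_def e2_def e3_def e4_def axis_def power2_eq_square)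

text \<open>The equations \<open>v \<and> z = 0\<close> that recover a Lagrangian plane from its Pluecker coordinates \<open>z\<close>.\<close>

definition plane_of :: "real^5 \<Rightarrow> (real^4) set" where
  "plane_of z = {v. v$3 * z$0 = v$1 * z$1 + v$2 * z$2 \<and> v$4 * z$0 = v$1 * z$2 + v$2 * z$3 \<and>
     v$1 * z$4 = v$3 * z$3 - v$4 * z$2 \<and> v$2 * z$4 = v$4 * z$1 - v$3 * z$2}"

lemma pluecker_eqs_span:
  fixes a1 a2 a3 a4 b1 b2 b3 b4 c d :: real
  assumes "a1 * b3 - a3 * b1 + a2 * b4 - a4 * b2 = 0"
  defines "v1 \<equiv> c * a1 + d * b1" and "v2 \<equiv> c * a2 + d * b2"
    and "v3 \<equiv> c * a3 + d * b3" and "v4 \<equiv> c * a4 + d * b4"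
  shows "v3 * (a1*b2 - a2*b1) = v1 * (a3*b2 - a2*b3) + v2 * (a1*b3 - a3*b1)"
    "v4 * (a1*b2 - a2*b1) = v1 * (a1*b3 - a3*b1) + v2 * (a1*b4 - a4*b1)"
    "v1 * (a3*b4 - a4*b3) = v3 * (a1*b4 - a4*b1) - v4 * (a1*b3 - a3*b1)"
    "v2 * (a3*b4 - a4*b3) = v4 * (a3*b2 - a2*b3) - v3 * (a1*b3 - a3*b1)"
proof -
  have s: "a1 * b3 - a3 * b1 = a4 * b2 - a2 * b4" using assms(1) by simp
  show "v3 * (a1*b2 - a2*b1) = v1 * (a3*b2 - a2*b3) + v2 * (a1*b3 - a3*b1)"
    "v1 * (a3*b4 - a4*b3) = v3 * (a1*b4 - a4*b1) - v4 * (a1*b3 - a3*b1)"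
    by (simp_all add: v1_def v2_def v3_def v4_def algebra_simps)
  show "v4 * (a1*b2 - a2*b1) = v1 * (a1*b3 - a3*b1) + v2 * (a1*b4 - a4*b1)"
    "v2 * (a3*b4 - a4*b3) = v4 * (a3*b2 - a2*b3) - v3 * (a1*b3 - a3*b1)"
    unfolding s by (simp_all add: v1_def v2_def v3_def v4_def algebra_simps)
qed

lemma plane_of_plucker_vec:
  assumes s: "omega a b = 0" and nz: "plucker_vec a b \<noteq> 0"
  shows "plane_of (plucker_vec a b) = span {a, b}"
proof (intro subset_antisym subsetI)
  fix v assume "v \<in> span {a, b}"
  then obtain c d where "v = c *\<^sub>R a + d *\<^sub>R b" unfolding span_pair by blast
  then show "v \<in> plane_of (plucker_vec a b)"
    using pluecker_eqs_span[of "a$1" "b$3" "a$3" "b$1" "a$2" "b$4" "a$4" "b$2" c d] s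
    by (simp add: plane_of_def omega_def)
next
  fix v assume v: "v \<in> plane_of (plucker_vec a b)"
  have eqs: "v$3 * (a$1*b$2 - a$2*b$1) = v$1 * (a$3*b$2 - a$2*b$3) + v$2 * (a$1*b$3 - a$3*b$1)"
    "v$4 * (a$1*b$2 - a$2*b$1) = v$1 * (a$1*b$3 - a$3*b$1) + v$2 * (a$1*b$4 - a$4*b$1)"
    "v$1 * (a$3*b$4 - a$4*b$3) = v$3 * (a$1*b$4 - a$4*b$1) - v$4 * (a$1*b$3 - a$3*b$1)"
    "v$2 * (a$3*b$4 - a$4*b$3) = v$4 * (a$3*b$2 - a$2*b$3) - v$3 * (a$1*b$3 - a$3*b$1)"
    using v by (simp_all add: plane_of_def)
  have "x * (a$1 * b$3 + a$2 * b$4) = x * (a$3 * b$1 + a$4 * b$2)" for x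
    using s by (simp add: omega_def)
  note s = this[of "v$1"] this[of "v$2"] this[of "v$3"] this[of "v$4"]
  have *: "v \<in> span {a, b}" if "p \<noteq> 0" "p *\<^sub>R v = c *\<^sub>R a + d *\<^sub>R b" for p c d
  proof -
    have "v = (c / p) *\<^sub>R a + (d / p) *\<^sub>R b"
      using that by (metis (no_types, lifting) divide_inverse_commute scaleR_one left_inverse
          scaleR_add_right scaleR_scaleR)
    then show ?thesis unfolding span_pair by blast
  qed
  consider "a$1*b$2 - a$2*b$1 \<noteq> 0" | "a$3*b$2 - a$2*b$3 \<noteq> 0" | "a$1*b$3 - a$3*b$1 \<noteq> 0"
    | "a$1*b$4 - a$4*b$1 \<noteq> 0" | "a$3*b$4 - a$4*b$3 \<noteq> 0"
    using nz by (auto simp: vec5_eq_iff)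
  then show "v \<in> span {a, b}"
  proof cases
    case 1
    show ?thesis
      by (rule *[OF 1, of "v$1 * b$2 - v$2 * b$1" "a$1 * v$2 - a$2 * v$1"])
         (use eqs s in \<open>auto simp: vec4_eq_iff algebra_simps\<close>)
  next
    case 2
    show ?thesis
      by (rule *[OF 2, of "v$3 * b$2 - v$2 * b$3" "a$3 * v$2 - a$2 * v$3"])
         (use eqs s in \<open>auto simp: vec4_eq_iff algebra_simps\<close>)
  next
    case 3
    show ?thesis
      by (rule *[OF 3, of "v$1 * b$3 - v$3 * b$1" "a$1 * v$3 - a$3 * v$1"])
         (use eqs s in \<open>auto simp: vec4_eq_iff algebra_simps\<close>)
  next
    case 4
    show ?thesis
      by (rule *[OF 4, of "v$1 * b$4 - v$4 * b$1" "a$1 * v$4 - a$4 * v$1"])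
         (use eqs s in \<open>auto simp: vec4_eq_iff algebra_simps\<close>)
  next
    case 5
    show ?thesis
      by (rule *[OF 5, of "v$3 * b$4 - v$4 * b$3" "a$3 * v$4 - a$4 * v$3"])
         (use eqs s in \<open>auto simp: vec4_eq_iff algebra_simps\<close>)
  qed
qed


lemma plane_of_scale: "c \<noteq> 0 \<Longrightarrow> plane_of (c *\<^sub>R z) = plane_of z"
proof -
  assume c: "c \<noteq> 0"
  have *: "c * x = c * y + c * w \<longleftrightarrow> x = y + w" "c * x = c * y - c * w \<longleftrightarrow> x = y - w" for x y w :: real
    using c by (metis distrib_left mult_cancel_left, metis right_diff_distrib mult_cancel_left)
  show ?thesis
    unfolding plane_of_def by (simp add: mult.left_commute[of _ c] *)
qed

lemma plucker_vec_nonzero: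
  assumes "independent {a, b}" "a \<noteq> b" "omega a b = 0"
  shows "plucker_vec a b \<noteq> 0"
proof
  assume "plucker_vec a b = 0"
  then have m: "a$1*b$2 = a$2*b$1" "a$1*b$3 = a$3*b$1" "a$1*b$4 = a$4*b$1" "a$3*b$2 = a$2*b$3"
    "a$3*b$4 = a$4*b$3" "a$2*b$4 = a$4*b$2"
    using assms(3) by (auto simp: vec5_eq_iff omega_def)
  have m': "a$i * b$j = a$j * b$i" for i j
    using exhaust_4[of i] exhaust_4[of j] m by (auto simp: mult.commute)
  have "a \<noteq> 0" using assms(1) dependent_zero by blast
  then obtain i where i: "a$i \<noteq> 0" by (auto simp: vec_eq_iff)
  have "b = (b$i / a$i) *\<^sub>R a"
    using i m'[of i] by (auto simp: vec_eq_iff field_simps)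
  then have "b \<in> span {a}" by (metis span_base span_scale singletonI)
  then show False using assms(1,2)
    by (metis dependent_def insert_Diff_if insertI1 insert_commute insert_absorb singleton_iff insert_Diff_single Diff_insert_absorb empty_iff)
qed

lemma plucker_vec_independent:
  assumes "plucker_vec a b \<noteq> 0"
  shows "a \<noteq> b" "independent {a, b}"
proof -
  have "plucker_vec (c *\<^sub>R b) b = 0" "plucker_vec 0 b = 0" "plucker_vec a 0 = 0" for c
    by (simp_all add: vec5_eq_iff)
  then have *: "a \<noteq> c *\<^sub>R b" "b \<noteq> 0" for c using assms by auto
  show "a \<noteq> b" using *(1)[of 1] by simp
  show "independent {a, b}"
    using * \<open>a \<noteq> b\<close> by (auto simp: independent_insert span_singleton)
qed

lemma LG24_iff:
  "L \<in> LG24 \<longleftrightarrow> (\<exists>a b. L = span {a, b} \<and> omega a b = 0 \<and> plucker_vec a b \<noteq> 0)"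
proof
  assume "L \<in> LG24"
  then have L: "subspace L" "dim L = 2" "\<And>a b. a \<in> L \<Longrightarrow> b \<in> L \<Longrightarrow> omega a b = 0"
    by (auto simp: LG24_def)
  obtain B where B: "B \<subseteq> L" "independent B" "L \<subseteq> span B" "card B = dim L"
    using basis_exists by blast
  then obtain a b where ab: "B = {a, b}" "a \<noteq> b" using L(2) by (auto simp: card_2_iff)
  have "L = span {a, b}" using B ab L(1) span_minimal by blast
  moreover have "omega a b = 0" using B ab L(3) by blast
  ultimately show "\<exists>a b. L = span {a, b} \<and> omega a b = 0 \<and> plucker_vec a b \<noteq> 0"
    using plucker_vec_nonzero B ab by blast
next
  assume "\<exists>a b. L = span {a, b} \<and> omega a b = 0 \<and> plucker_vec a b \<noteq> 0"
  then obtain a b where L: "L = span {a, b}" and s: "omega a b = 0" and n: "plucker_vec a b \<noteq> 0" by blast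
  have "dim L = 2"
    using plucker_vec_independent[OF n] by (simp add: L dim_eq_card_independent)
  moreover have "omega v w = 0" if vL: "v \<in> L" and wL: "w \<in> L" for v w
  proof -
    obtain c d where v: "v = c *\<^sub>R a + d *\<^sub>R b"
      using vL unfolding L span_pair by blast
    obtain c' d' where w: "w = c' *\<^sub>R a + d' *\<^sub>R b"
      using wL unfolding L span_pair by blast
    have "omega v w = (c * d' - d * c') * omega a b"
      by (simp add: v w omega_def algebra_simps)
    with s show ?thesis by simp
  qed
  ultimately show "L \<in> LG24" by (simp add: LG24_def L)
qed

lemma bil_plucker_vec:
  assumes "omega a b = 0" shows "bil (plucker_vec a b) (plucker_vec a b) = 0"
  using assms unfolding bil_def omega_def by simp algebra

lemma quadric_plucker_vec:
  assumes z: "z \<noteq> 0" "bil z z = 0"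
  shows "\<exists>a b c. c \<noteq> 0 \<and> plucker_vec a b = c *\<^sub>R z \<and> omega a b = 0"
proof -
  define r :: "real \<Rightarrow> real \<Rightarrow> real \<Rightarrow> real \<Rightarrow> real^4" where
    "r x1 x2 x3 x4 = (\<chi> i. if i = 1 then x1 else if i = 2 then x2 else if i = 3 then x3 else x4)"
    for x1 x2 x3 x4
  have r: "r x1 x2 x3 x4 $ 1 = x1" "r x1 x2 x3 x4 $ 2 = x2" "r x1 x2 x3 x4 $ 3 = x3"
    "r x1 x2 x3 x4 $ 4 = x4" for x1 x2 x3 x4 by (simp_all add: r_def)
  have q: "z$0 * z$4 = z$1 * z$3 - z$2 * z$2" using z(2) by (simp add: bil_def)
  let ?r1 = "r 0 (z$0) (z$2) (z$3)" and ?r2 = "r (- z$0) 0 (- z$1) (- z$2)"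
    and ?r3 = "r (- z$2) (z$1) 0 (z$4)" and ?r4 = "r (- z$3) (z$2) (- z$4) 0"
  consider "z$0 \<noteq> 0" | "z$1 \<noteq> 0" | "z$2 \<noteq> 0" | "z$3 \<noteq> 0" | "z$4 \<noteq> 0"
    using z(1) by (auto simp: vec5_eq_iff)
  then show ?thesis
  proof cases
    case 1
    have "plucker_vec ?r1 ?r2 = (z$0) *\<^sub>R z" "omega ?r1 ?r2 = 0"
      using q by (simp_all add: vec5_eq_iff r omega_def algebra_simps)
    with 1 show ?thesis by blast
  next
    case 2
    have "plucker_vec ?r2 ?r3 = (- z$1) *\<^sub>R z" "omega ?r2 ?r3 = 0"
      using q by (simp_all add: vec5_eq_iff r omega_def algebra_simps)
    with 2 show ?thesis by (metis neg_equal_0_iff_equal)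
  next
    case 3
    have "plucker_vec ?r1 ?r3 = (z$2) *\<^sub>R z" "omega ?r1 ?r3 = 0"
      using q by (simp_all add: vec5_eq_iff r omega_def algebra_simps)
    with 3 show ?thesis by blast
  next
    case 4
    have "plucker_vec ?r1 ?r4 = (z$3) *\<^sub>R z" "omega ?r1 ?r4 = 0"
      using q by (simp_all add: vec5_eq_iff r omega_def algebra_simps)
    with 4 show ?thesis by blast
  next
    case 5
    have "plucker_vec ?r3 ?r4 = (z$4) *\<^sub>R z" "omega ?r3 ?r4 = 0"
      using q by (simp_all add: vec5_eq_iff r omega_def algebra_simps)
    with 5 show ?thesis by blast
  qed
qed

lemma ppoint_scale: "c \<noteq> 0 \<Longrightarrow> ppoint (c *\<^sub>R z) = ppoint z"
  unfolding ppoint_def using span_image_scale[of "{z}" "\<lambda>_. c"] by simp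

lemma bij_betw_plucker: "bij_betw plucker LG24 quadric"
proof (rule bij_betw_imageI)
  show "inj_on plucker LG24"
  proof (rule inj_onI)
    fix L L' assume "L \<in> LG24" "L' \<in> LG24" and eq: "plucker L = plucker L'"
    then obtain a b a' b' where
      L: "L = span {a, b}" "omega a b = 0" "plucker_vec a b \<noteq> 0" and
      L': "L' = span {a', b'}" "omega a' b' = 0" "plucker_vec a' b' \<noteq> 0"
      unfolding LG24_iff by blast
    have "ppoint (plucker_vec a b) = ppoint (plucker_vec a' b')" using eq L L' by (simp add: plucker_span)
    then have "plucker_vec a b \<in> ppoint (plucker_vec a' b')" by (metis ppoint_def span_base singletonI)
    then obtain c where c: "plucker_vec a b = c *\<^sub>R plucker_vec a' b'"
      by (auto simp: ppoint_def span_singleton)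
    then have "c \<noteq> 0" using L by auto
    then show "L = L'"
      using plane_of_plucker_vec[OF L(2,3)] plane_of_plucker_vec[OF L'(2,3)] plane_of_scale c L(1) L'(1)
      by metis
  qed
  show "plucker ` LG24 = quadric"
  proof (intro subset_antisym subsetI)
    fix p assume "p \<in> plucker ` LG24"
    then show "p \<in> quadric"
      by (auto simp: LG24_iff plucker_span quadric_def bil_plucker_vec)
  next
    fix p assume "p \<in> quadric"
    then obtain z where z: "p = ppoint z" "z \<noteq> 0" "bil z z = 0" by (auto simp: quadric_def)
    then obtain a b c where abc: "c \<noteq> 0" "plucker_vec a b = c *\<^sub>R z" "omega a b = 0"
      using quadric_plucker_vec by blast
    then have "span {a, b} \<in> LG24" "plucker (span {a, b}) = p"
      using z unfolding LG24_iff by (metis scaleR_eq_0_iff, simp add: plucker_span ppoint_scale)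
    then show "p \<in> plucker ` LG24" by blast
  qed
qed

end

theory Submission
  imports Defs
begin

text \<open>If \<open>\<ell>\<^sub>1 = \<ell>\<^sub>2 = 0\<close>, the second fundamental form \<open>-\<langle>dn, dx\<rangle>\<close> vanishes in both null directions of the first
  fundamental form, hence is a multiple \<open>\<lambda>\<langle>dx, dx\<rangle>\<close> of it. Then \<open>m = n + \<lambda> x\<close> satisfies \<open>dm = \<beta> x\<close>, and
  \<open>d(dm) = 0\<close> forces \<open>\<beta> = 0\<close>, so \<open>m\<close> is locally constant and \<open>M\<close> lies locally in the sphere of \<open>m\<close>.
  Two vectors \<open>m\<close>, \<open>m'\<close> orthogonal to an open piece of \<open>M\<close> are proportional: a combination of them that is
  orthogonal to \<open>m\<close> is a fixed vector proportional to \<open>x(u)\<close> for every \<open>u\<close>, so it is \<open>0\<close>. By connectedness, a single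
  sphere contains \<open>M\<close>, and \<open>M\<close> is open in it by invariance of domain. Conversely, on a sphere with pole
  \<open>z\<close> the normal field may be chosen as a constant multiple of \<open>z\<close>.\<close>

section \<open>Calculus of smooth maps\<close>

lemma Ck_on_has_derivative:
  "Ck_on (Suc k) f S \<Longrightarrow> u \<in> S \<Longrightarrow> (f has_derivative frechet_derivative f (at u)) (at u)"
  by (simp add: frechet_derivative_works)

text \<open>At points of an open set, derivatives depend only on the values in that set. So formulas
  valid only on \<open>S\<close> can be substituted at every order, although
  \<open>frechet_derivative\<close> refers to total functions.\<close>

lemma Ck_on_cong:
  assumes "open S" "\<And>u. u \<in> S \<Longrightarrow> f u = g u" "Ck_on k f S"
  shows "Ck_on k g S"
  using assms
proof (induction k arbitrary: f g)
  case 0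
  then show ?case by (simp add: continuous_on_eq)
next
  case (Suc k)
  have der: "(g has_derivative frechet_derivative f (at u)) (at u)" if "u \<in> S" for u
    using has_derivative_transform_within_open[OF Ck_on_has_derivative[OF Suc.prems(3) that] Suc.prems(1) that]
      Suc.prems(2) by blast
  then have "frechet_derivative f (at u) = frechet_derivative g (at u)" if "u \<in> S" for u
    using frechet_derivative_at that by blast
  then have "Ck_on k (\<lambda>u. frechet_derivative g (at u) v) S" for v
    using Suc.IH[of "\<lambda>u. frechet_derivative f (at u) v"] Suc.prems by simp
  with der show ?case by (auto simp: differentiable_def)
qed

text \<open>The inductive step of the arithmetic closure properties below: an explicit derivative
  formula stands in for \<open>frechet_derivative\<close>, and only that formula has to be shown
  C^k.\<close>

lemma Ck_on_SucI:
  assumes "open S" "\<And>u. u \<in> S \<Longrightarrow> (f has_derivative f' u) (at u)"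
    "\<And>v. Ck_on k (\<lambda>u. f' u v) S"
  shows "Ck_on (Suc k) f S"
proof -
  have "frechet_derivative f (at u) = f' u" if "u \<in> S" for u
    using frechet_derivative_at[OF assms(2)[OF that]] by simp
  then have "Ck_on k (\<lambda>u. frechet_derivative f (at u) v) S" for v
    by (intro Ck_on_cong[OF assms(1) _ assms(3)[of v]]) simp
  with assms(2) show ?thesis by (auto simp: differentiable_def)
qed

lemma Ck_on_Suc_imp: "Ck_on (Suc k) f S \<Longrightarrow> Ck_on k f S"
proof (induction k arbitrary: f)
  case 0
  then show ?case
    by (auto intro!: continuous_at_imp_continuous_on dest: differentiable_imp_continuous_within)
next
  case (Suc k)
  then show ?case by (metis Ck_on.simps(2))
qed

lemma Ck_on_subset: "Ck_on k f S \<Longrightarrow> T \<subseteq> S \<Longrightarrow> Ck_on k f T"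
  by (induction k arbitrary: f) (auto intro: continuous_on_subset)

lemma Ck_on_const: "open S \<Longrightarrow> Ck_on k (\<lambda>u. c) S"
proof (induction k arbitrary: c)
  case (Suc k)
  show ?case by (rule Ck_on_SucI[OF Suc.prems has_derivative_const]) (rule Suc.IH[OF Suc.prems])
qed simp

lemma Ck_on_add:
  "open S \<Longrightarrow> Ck_on k f S \<Longrightarrow> Ck_on k g S \<Longrightarrow> Ck_on k (\<lambda>u. f u + g u) S"
proof (induction k arbitrary: f g)
  case 0
  then show ?case by (simp add: continuous_on_add)
next
  case (Suc k)
  show ?case
    by (rule Ck_on_SucI[OF Suc.prems(1) has_derivative_add[OF Ck_on_has_derivative Ck_on_has_derivative]])
      (use Suc in auto)
qed

lemma Ck_on_linear:
  "bounded_linear h \<Longrightarrow> open S \<Longrightarrow> Ck_on k f S \<Longrightarrow> Ck_on k (\<lambda>u. h (f u)) S"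
proof (induction k arbitrary: f)
  case 0
  then show ?case by (simp add: bounded_linear.continuous_on)
next
  case (Suc k)
  show ?case
    by (rule Ck_on_SucI[OF Suc.prems(2) bounded_linear.has_derivative[OF Suc.prems(1) Ck_on_has_derivative]])
      (use Suc in auto)
qed

text \<open>The product rule gives two terms, each again \<open>h\<close> of one differentiated and
  one undifferentiated factor. The induction hypothesis for the same \<open>h\<close> applies to
  both, with \<open>Ck_on_Suc_imp\<close> lowering the order of the undifferentiated factor.\<close>

lemma Ck_on_bilinear:
  assumes "bounded_bilinear h"
  shows "open S \<Longrightarrow> Ck_on k f S \<Longrightarrow> Ck_on k g S \<Longrightarrow> Ck_on k (\<lambda>u. h (f u) (g u)) S"
proof (induction k arbitrary: f g)
  case 0
  then show ?case by (simp add: bounded_bilinear.continuous_on[OF assms])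
next
  case (Suc k)
  have "Ck_on k (\<lambda>u. h (f u) (frechet_derivative g (at u) v) + h (frechet_derivative f (at u) v) (g u)) S" for v
    using Suc.prems
    by (intro Ck_on_add Suc.IH Ck_on_Suc_imp[OF Suc.prems(2)] Ck_on_Suc_imp[OF Suc.prems(3)]) auto
  then show ?case
    by (intro Ck_on_SucI[OF Suc.prems(1) bounded_bilinear.FDERIV[OF assms
            Ck_on_has_derivative[OF Suc.prems(2)] Ck_on_has_derivative[OF Suc.prems(3)]]])
qed

text \<open>The derivative of 1/f is -(1/f) f' (1/f), built from f' and from 1/f itself, which is
  C^k by induction.\<close>

lemma Ck_on_inverse:
  fixes f :: "'a::euclidean_space \<Rightarrow> real"
  assumes "open S" "\<And>u. u \<in> S \<Longrightarrow> f u \<noteq> 0"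
  shows "Ck_on k f S \<Longrightarrow> Ck_on k (\<lambda>u. inverse (f u)) S"
proof (induction k)
  case 0
  then show ?case using assms by (simp add: continuous_on_inverse)
next
  case (Suc k)
  have i: "Ck_on k (\<lambda>u. inverse (f u)) S" by (rule Suc.IH[OF Ck_on_Suc_imp[OF Suc.prems]])
  note m = Ck_on_bilinear[OF bounded_bilinear_mult assms(1)]
  show ?case
    by (rule Ck_on_SucI[OF assms(1) Deriv.has_derivative_inverse[OF assms(2) Ck_on_has_derivative[OF Suc.prems]]],
        assumption+, rule Ck_on_linear[OF bounded_linear_minus[OF bounded_linear_ident] assms(1)])
      (use i Suc.prems in \<open>auto intro!: m\<close>)
qed

text \<open>The derivative f' / (2 sqrt f) involves only f' and the reciprocal of the root, which is
  C^k by induction and \<open>Ck_on_inverse\<close>.\<close>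

lemma Ck_on_sqrt:
  fixes f :: "'a::euclidean_space \<Rightarrow> real"
  assumes "open S" "\<And>u. u \<in> S \<Longrightarrow> f u > 0"
  shows "Ck_on k f S \<Longrightarrow> Ck_on k (\<lambda>u. sqrt (f u)) S"
proof (induction k)
  case 0
  then show ?case by (simp add: continuous_on_real_sqrt)
next
  case (Suc k)
  have i: "Ck_on k (\<lambda>u. inverse (sqrt (f u))) S"
  proof (rule Ck_on_inverse[OF assms(1)])
    show "sqrt (f u) \<noteq> 0" if "u \<in> S" for u using assms(2)[OF that] by simp
    show "Ck_on k (\<lambda>u. sqrt (f u)) S" by (rule Suc.IH[OF Ck_on_Suc_imp[OF Suc.prems]])
  qed
  note m = Ck_on_bilinear[OF bounded_bilinear_mult assms(1)]
  have "((\<lambda>u. sqrt (f u)) has_derivative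
      (\<lambda>v. frechet_derivative f (at u) v * (inverse (sqrt (f u)) / 2))) (at u)" if "u \<in> S" for u
    by (rule has_derivative_real_sqrt[OF assms(2)[OF that] Ck_on_has_derivative[OF Suc.prems that]])
  then show ?case
  proof (rule Ck_on_SucI[OF assms(1)])
    fix v
    have "Ck_on k (\<lambda>u. inverse (sqrt (f u)) / 2) S"
      by (rule Ck_on_linear[OF bounded_linear_divide assms(1) i])
    then show "Ck_on k (\<lambda>u. frechet_derivative f (at u) v * (inverse (sqrt (f u)) / 2)) S"
      using m[OF _ \<open>Ck_on k (\<lambda>u. inverse (sqrt (f u)) / 2) S\<close>] Suc.prems by simp
  qed
qed

lemma smooth_on_subset: "smooth_on S f \<Longrightarrow> T \<subseteq> S \<Longrightarrow> smooth_on T f"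
  by (auto simp: smooth_on_def intro: Ck_on_subset)

lemma smooth_on_has_derivative:
  "smooth_on S f \<Longrightarrow> u \<in> S \<Longrightarrow> (f has_derivative frechet_derivative f (at u)) (at u)"
  unfolding smooth_on_def using Ck_on_has_derivative by blast

lemma smooth_on_linear_derivative:
  "smooth_on S f \<Longrightarrow> u \<in> S \<Longrightarrow> linear (frechet_derivative f (at u))"
  using smooth_on_has_derivative has_derivative_linear by blast

lemma smooth_on_continuous: "smooth_on S f \<Longrightarrow> continuous_on S f"
  unfolding smooth_on_def by (metis Ck_on.simps(1))

lemma smooth_on_derivative:
  "smooth_on S f \<Longrightarrow> smooth_on S (\<lambda>u. frechet_derivative f (at u) v)"
  unfolding smooth_on_def by (metis Ck_on.simps(2))

lemma smooth_on_const: "open S \<Longrightarrow> smooth_on S (\<lambda>u. c)"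
  by (simp add: smooth_on_def Ck_on_const)

lemma smooth_on_add:
  "open S \<Longrightarrow> smooth_on S f \<Longrightarrow> smooth_on S g \<Longrightarrow> smooth_on S (\<lambda>u. f u + g u)"
  by (simp add: smooth_on_def Ck_on_add)

lemma smooth_on_linear:
  "bounded_linear h \<Longrightarrow> open S \<Longrightarrow> smooth_on S f \<Longrightarrow> smooth_on S (\<lambda>u. h (f u))"
  by (simp add: smooth_on_def Ck_on_linear)

lemma smooth_on_bilinear:
  "bounded_bilinear h \<Longrightarrow> open S \<Longrightarrow> smooth_on S f \<Longrightarrow> smooth_on S g \<Longrightarrow>
    smooth_on S (\<lambda>u. h (f u) (g u))"
  by (simp add: smooth_on_def Ck_on_bilinear)

lemmas smooth_on_scaleR = smooth_on_bilinear[OF bounded_bilinear_scaleR]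
lemmas smooth_on_mult = smooth_on_bilinear[OF bounded_bilinear_mult]
lemmas smooth_on_minus = smooth_on_linear[OF bounded_linear_minus[OF bounded_linear_ident]]

lemma smooth_on_inverse:
  fixes f :: "'a::euclidean_space \<Rightarrow> real"
  shows "open S \<Longrightarrow> (\<And>u. u \<in> S \<Longrightarrow> f u \<noteq> 0) \<Longrightarrow> smooth_on S f \<Longrightarrow> smooth_on S (\<lambda>u. inverse (f u))"
  by (simp add: smooth_on_def Ck_on_inverse)

lemma smooth_on_sqrt:
  fixes f :: "'a::euclidean_space \<Rightarrow> real"
  shows "open S \<Longrightarrow> (\<And>u. u \<in> S \<Longrightarrow> f u > 0) \<Longrightarrow> smooth_on S f \<Longrightarrow> smooth_on S (\<lambda>u. sqrt (f u))"
  by (simp add: smooth_on_def Ck_on_sqrt)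

lemma smooth_on_cong:
  "open S \<Longrightarrow> (\<And>u. u \<in> S \<Longrightarrow> f u = g u) \<Longrightarrow> smooth_on S f \<Longrightarrow> smooth_on S g"
  unfolding smooth_on_def by (metis Ck_on_cong)

lemma linear_real2_expand:
  fixes L :: "real^2 \<Rightarrow> 'b::real_vector"
  assumes "linear L"
  shows "L v = v$1 *\<^sub>R L (axis 1 1) + v$2 *\<^sub>R L (axis 2 1)"
proof -
  have "v = v$1 *\<^sub>R axis 1 1 + v$2 *\<^sub>R axis 2 1"
    by (simp add: vec_eq_iff forall_2 axis_def)
  then have "L v = L (v$1 *\<^sub>R axis 1 1 + v$2 *\<^sub>R axis 2 1)" by simp
  also have "\<dots> = v$1 *\<^sub>R L (axis 1 1) + v$2 *\<^sub>R L (axis 2 1)"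
    by (simp only: linear_add[OF assms] linear_scale[OF assms])
  finally show ?thesis .
qed

text \<open>\<open>Ck_on\<close> differentiates in fixed directions, whereas \<open>N\<close>
  varies. Expanding \<open>N\<close> in the standard basis gives a combination of fixed-direction
  derivatives with smooth coefficients.\<close>

lemma smooth_on_along:
  assumes "open D" "smooth_on D N" "smooth_on D f"
  shows "smooth_on D (along N f)"
proof -
  have "smooth_on D (\<lambda>u. N u $ 1 *\<^sub>R frechet_derivative f (at u) (axis 1 1)
      + N u $ 2 *\<^sub>R frechet_derivative f (at u) (axis 2 1))"
    by (intro smooth_on_add smooth_on_scaleR smooth_on_derivative assms
        smooth_on_linear[OF bounded_linear_vec_nth])
  then show ?thesis
    by (rule smooth_on_cong[OF assms(1), rotated])
      (unfold along_def, rule linear_real2_expand[OF smooth_on_linear_derivative[OF assms(3)], symmetric])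
qed

lemma smooth_on_real2_pair:
  fixes f g :: "'a::euclidean_space \<Rightarrow> real"
  assumes "open D" "smooth_on D f" "smooth_on D g"
  shows "smooth_on D (\<lambda>u. vector [f u, g u] :: real^2)"
proof -
  have "smooth_on D (\<lambda>u. f u *\<^sub>R axis 1 1 + g u *\<^sub>R axis 2 1 :: real^2)"
    by (intro smooth_on_add smooth_on_scaleR smooth_on_const assms)
  then show ?thesis
    by (rule smooth_on_cong[OF assms(1), rotated])
      (simp add: vec_eq_iff forall_2 axis_def)
qed

section \<open>Symmetry of second derivatives\<close>

text \<open>The mean value theorem is used twice: in \<open>s\<close> for the difference of
  \<open>f\<close> across the parallelogram, then in \<open>t\<close> for the derivative along
  \<open>v\<close>. The left side is symmetric in \<open>v\<close> and \<open>w\<close>, which is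
  the source of the symmetry of second derivatives.\<close>

lemma mixed_difference_mean_value:
  fixes f :: "'a::euclidean_space \<Rightarrow> real"
  assumes f: "\<And>y. y \<in> S \<Longrightarrow> (f has_derivative frechet_derivative f (at y)) (at y)"
    and fv: "\<And>y. y \<in> S \<Longrightarrow> ((\<lambda>z. frechet_derivative f (at z) v) has_derivative F y) (at y)"
    and h: "h > 0"
    and S: "\<And>s t. 0 \<le> s \<Longrightarrow> s \<le> h \<Longrightarrow> 0 \<le> t \<Longrightarrow> t \<le> h \<Longrightarrow> u + s *\<^sub>R v + t *\<^sub>R w \<in> S"
  shows "\<exists>s t. 0 < s \<and> s < h \<and> 0 < t \<and> t < h \<and>
    f (u + h *\<^sub>R v + h *\<^sub>R w) - f (u + h *\<^sub>R v) - f (u + h *\<^sub>R w) + f u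
      = h * h * F (u + s *\<^sub>R v + t *\<^sub>R w) w"
proof -
  define g where "g s t = f (u + s *\<^sub>R v + t *\<^sub>R w)" for s t
  have g': "((\<lambda>s. g s t) has_real_derivative frechet_derivative f (at (u + s *\<^sub>R v + t *\<^sub>R w)) v) (at s)"
    if "0 \<le> s" "s \<le> h" "0 \<le> t" "t \<le> h" for s t
  proof -
    have d: "((\<lambda>s. u + s *\<^sub>R v + t *\<^sub>R w) has_derivative (\<lambda>r. r *\<^sub>R v)) (at s)"
      by (auto intro!: derivative_eq_intros)
    have "((\<lambda>s. g s t) has_derivative
        (\<lambda>r. frechet_derivative f (at (u + s *\<^sub>R v + t *\<^sub>R w)) (r *\<^sub>R v))) (at s)"
      unfolding g_def using has_derivative_compose[OF d f[OF S[OF that]]] .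
    then show ?thesis
      using linear_scale[OF has_derivative_linear[OF f[OF S[OF that]]]]
      by (simp add: has_field_derivative_def mult_commute_abs)
  qed
  have F': "((\<lambda>t. frechet_derivative f (at (u + s *\<^sub>R v + t *\<^sub>R w)) v) has_real_derivative
      F (u + s *\<^sub>R v + t *\<^sub>R w) w) (at t)"
    if "0 \<le> s" "s \<le> h" "0 \<le> t" "t \<le> h" for s t
  proof -
    have d: "((\<lambda>t. u + s *\<^sub>R v + t *\<^sub>R w) has_derivative (\<lambda>r. r *\<^sub>R w)) (at t)"
      by (auto intro!: derivative_eq_intros)
    show ?thesis
      using has_derivative_compose[OF d fv[OF S[OF that]]] linear_scale[OF has_derivative_linear[OF fv[OF S[OF that]]]]
      by (simp add: has_field_derivative_def mult_commute_abs)
  qed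
  have "((\<lambda>s. g s h - g s 0) has_real_derivative
      frechet_derivative f (at (u + s *\<^sub>R v + h *\<^sub>R w)) v - frechet_derivative f (at (u + s *\<^sub>R v + 0 *\<^sub>R w)) v) (at s)"
    if "0 \<le> s" "s \<le> h" for s
    using that h by (intro DERIV_diff g') auto
  from MVT2[OF h this] obtain s where s: "0 < s" "s < h"
    "(g h h - g h 0) - (g 0 h - g 0 0) = h *
      (frechet_derivative f (at (u + s *\<^sub>R v + h *\<^sub>R w)) v - frechet_derivative f (at (u + s *\<^sub>R v + 0 *\<^sub>R w)) v)"
    by auto
  from MVT2[OF h F'[of s]] s obtain t where t: "0 < t" "t < h"
    "frechet_derivative f (at (u + s *\<^sub>R v + h *\<^sub>R w)) v - frechet_derivative f (at (u + s *\<^sub>R v + 0 *\<^sub>R w)) v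
      = h * F (u + s *\<^sub>R v + t *\<^sub>R w) w"
    by auto
  have "(g h h - g h 0) - (g 0 h - g 0 0) = h * h * F (u + s *\<^sub>R v + t *\<^sub>R w) w"
    using s(3) t(3) by simp
  then show ?thesis using s t by (intro exI[of _ s] exI[of _ t]) (simp add: g_def)
qed

lemma tendsto_small_square:
  fixes u v w :: "'a::real_normed_vector"
  assumes "\<And>n. 0 \<le> s n" "\<And>n. s n \<le> h n" "\<And>n. 0 \<le> t n" "\<And>n. t n \<le> h n" "h \<longlonglongrightarrow> 0"
  shows "(\<lambda>n. u + s n *\<^sub>R v + t n *\<^sub>R w) \<longlonglongrightarrow> u"
proof -
  have "s \<longlonglongrightarrow> 0" "t \<longlonglongrightarrow> 0"
    using assms by (auto intro!: tendsto_sandwich[OF _ _ tendsto_const assms(5)])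
  then have "(\<lambda>n. u + s n *\<^sub>R v + t n *\<^sub>R w) \<longlonglongrightarrow> u + 0 *\<^sub>R v + 0 *\<^sub>R w"
    by (intro tendsto_intros)
  then show ?thesis by simp
qed

text \<open>One and the same second difference equals h^2 times either mixed derivative, each at
  some point of a shrinking parallelogram. Cancelling h^2 and letting h tend to 0 gives equality at
  \<open>u\<close> by continuity.\<close>

lemma mixed_partials_real:
  fixes f :: "'a::euclidean_space \<Rightarrow> real"
  assumes S: "open S" "u \<in> S" and f: "smooth_on S f"
  shows "frechet_derivative (\<lambda>z. frechet_derivative f (at z) v) (at u) w
       = frechet_derivative (\<lambda>z. frechet_derivative f (at z) w) (at u) v" (is "?A v w u = ?A w v u")
proof -
  obtain e where e: "e > 0" "ball u e \<subseteq> S" using S openE by blast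
  \<comment> \<open>Parallelograms with sides at most \<open>c\<close> times \<open>v\<close> and
    \<open>w\<close> stay inside the ball of radius \<open>e\<close>; the summand 1 covers the case
    \<open>v = w = 0\<close>.\<close>
  define c where "c = e / (norm v + norm w + 1)"
  have c: "c > 0" using e by (auto simp: c_def intro!: divide_pos_pos add_nonneg_pos)
  define h where "h n = c / Suc n" for n
  have h0: "h n > 0" for n using c by (simp add: h_def)
  \<comment> \<open>The hypothesis on norms makes this serve both orders of \<open>v\<close> and
    \<open>w\<close>.\<close>
  have in_S: "u + s *\<^sub>R a + t *\<^sub>R b \<in> S"
    if "0 \<le> s" "s \<le> h n" "0 \<le> t" "t \<le> h n" "norm a + norm b = norm v + norm w" for s t n a b
  proof -
    have hc: "h n \<le> c" using c by (simp add: h_def divide_le_eq mult_le_cancel_left1)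
    have "norm (s *\<^sub>R a + t *\<^sub>R b) \<le> s * norm a + t * norm b"
      using norm_triangle_ineq[of "s *\<^sub>R a" "t *\<^sub>R b"] that by simp
    also have "\<dots> \<le> c * norm a + c * norm b"
      using that hc by (intro add_mono mult_right_mono) auto
    also have "\<dots> = c * (norm v + norm w)" using that(5) by (simp add: distrib_left[symmetric])
    also have "\<dots> < c * (norm v + norm w + 1)" using c by simp
    also have "\<dots> = e" using add_nonneg_pos[of "norm v + norm w" 1] by (simp add: c_def)
    finally have "u + s *\<^sub>R a + t *\<^sub>R b \<in> ball u e"
      by (metis add.assoc add_diff_cancel_left' dist_commute dist_norm mem_ball)
    then show ?thesis using e by blast
  qed
  have mv: "\<exists>s t. 0 < s \<and> s < h n \<and> 0 < t \<and> t < h n \<and>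
     f (u + h n *\<^sub>R a + h n *\<^sub>R b) - f (u + h n *\<^sub>R a) - f (u + h n *\<^sub>R b) + f u
      = h n * h n * ?A a b (u + s *\<^sub>R a + t *\<^sub>R b)" if "norm a + norm b = norm v + norm w" for a b n
    by (rule mixed_difference_mean_value[OF smooth_on_has_derivative[OF f]
          smooth_on_has_derivative[OF smooth_on_derivative[OF f]] h0 in_S])
      (use that in auto)
  have "\<forall>n. \<exists>s t. 0 < s \<and> s < h n \<and> 0 < t \<and> t < h n \<and>
     f (u + h n *\<^sub>R v + h n *\<^sub>R w) - f (u + h n *\<^sub>R v) - f (u + h n *\<^sub>R w) + f u
      = h n * h n * ?A v w (u + s *\<^sub>R v + t *\<^sub>R w)" by (intro allI mv) simp
  then obtain s t where st: "\<And>n. 0 < s n" "\<And>n. s n < h n" "\<And>n. 0 < t n" "\<And>n. t n < h n"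
     "\<And>n. f (u + h n *\<^sub>R v + h n *\<^sub>R w) - f (u + h n *\<^sub>R v) - f (u + h n *\<^sub>R w) + f u
      = h n * h n * ?A v w (u + s n *\<^sub>R v + t n *\<^sub>R w)" by metis
  have "\<forall>n. \<exists>s t. 0 < s \<and> s < h n \<and> 0 < t \<and> t < h n \<and>
     f (u + h n *\<^sub>R w + h n *\<^sub>R v) - f (u + h n *\<^sub>R w) - f (u + h n *\<^sub>R v) + f u
      = h n * h n * ?A w v (u + s *\<^sub>R w + t *\<^sub>R v)" by (intro allI mv) simp
  then obtain s' t' where st': "\<And>n. 0 < s' n" "\<And>n. s' n < h n" "\<And>n. 0 < t' n" "\<And>n. t' n < h n"
     "\<And>n. f (u + h n *\<^sub>R w + h n *\<^sub>R v) - f (u + h n *\<^sub>R w) - f (u + h n *\<^sub>R v) + f u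
      = h n * h n * ?A w v (u + s' n *\<^sub>R w + t' n *\<^sub>R v)" by metis
  have eq: "?A v w (u + s n *\<^sub>R v + t n *\<^sub>R w) = ?A w v (u + s' n *\<^sub>R w + t' n *\<^sub>R v)" for n
  proof -
    have "h n * h n * ?A v w (u + s n *\<^sub>R v + t n *\<^sub>R w) = h n * h n * ?A w v (u + s' n *\<^sub>R w + t' n *\<^sub>R v)"
      using st(5)[of n] st'(5)[of n] add.assoc[of u] add.commute[of "h n *\<^sub>R w"]
      by (smt (verit, best))
    then show ?thesis using h0[of n] by simp
  qed
  have h: "h \<longlonglongrightarrow> 0"
    using tendsto_mult_right_zero[OF LIMSEQ_inverse_real_of_nat, of c] by (simp add: h_def[abs_def] divide_inverse)
  have cont: "isCont (?A a b) u" for a b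
    using smooth_on_continuous[OF smooth_on_derivative[OF smooth_on_derivative[OF f]]] S
    by (simp add: continuous_on_eq_continuous_at)
  have "(\<lambda>n. ?A v w (u + s n *\<^sub>R v + t n *\<^sub>R w)) \<longlonglongrightarrow> ?A v w u"
    by (rule isCont_tendsto_compose[OF cont tendsto_small_square[of s h t]])
      (use st h in \<open>auto intro: less_imp_le\<close>)
  moreover have "(\<lambda>n. ?A w v (u + s' n *\<^sub>R w + t' n *\<^sub>R v)) \<longlonglongrightarrow> ?A w v u"
    by (rule isCont_tendsto_compose[OF cont tendsto_small_square[of s' h t']])
      (use st' h in \<open>auto intro: less_imp_le\<close>)
  ultimately show ?thesis unfolding eq by (rule LIMSEQ_unique)
qed

lemma frechet_derivative_linear:
  assumes "bounded_linear h" "f differentiable (at u)"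
  shows "frechet_derivative (\<lambda>z. h (f z)) (at u) v = h (frechet_derivative f (at u) v)"
  using frechet_derivative_at[OF bounded_linear.has_derivative[OF assms(1)
        frechet_derivative_works[THEN iffD1, OF assms(2)]]] by metis

text \<open>Inner products with basis vectors commute with differentiation, so the real case applies
  to each coordinate.\<close>

lemma mixed_partials:
  fixes f :: "'a::euclidean_space \<Rightarrow> 'b::euclidean_space"
  assumes S: "open S" "u \<in> S" and f: "smooth_on S f"
  shows "frechet_derivative (\<lambda>z. frechet_derivative f (at z) v) (at u) w
       = frechet_derivative (\<lambda>z. frechet_derivative f (at z) w) (at u) v"
proof (rule euclidean_eqI)
  fix b :: 'b assume "b \<in> Basis"
  have dif: "f differentiable (at z)" if "z \<in> S" for z
    using smooth_on_has_derivative[OF f that] by (auto simp: differentiable_def)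
  have *: "frechet_derivative (\<lambda>z. frechet_derivative f (at z) v) (at u) w \<bullet> b
     = frechet_derivative (\<lambda>z. frechet_derivative (\<lambda>y. f y \<bullet> b) (at z) v) (at u) w" for v w
  proof -
    have "((\<lambda>z. frechet_derivative f (at z) v \<bullet> b) has_derivative
        (\<lambda>w. frechet_derivative (\<lambda>z. frechet_derivative f (at z) v) (at u) w \<bullet> b)) (at u)"
      by (rule bounded_linear.has_derivative[OF bounded_linear_inner_left
            smooth_on_has_derivative[OF smooth_on_derivative[OF f] S(2)]])
    then have "((\<lambda>z. frechet_derivative (\<lambda>y. f y \<bullet> b) (at z) v) has_derivative
        (\<lambda>w. frechet_derivative (\<lambda>z. frechet_derivative f (at z) v) (at u) w \<bullet> b)) (at u)"
      by (rule has_derivative_transform_within_open[OF _ S])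
        (simp add: frechet_derivative_linear[OF bounded_linear_inner_left dif])
    from fun_cong[OF frechet_derivative_at[OF this]] show ?thesis .
  qed
  show "frechet_derivative (\<lambda>z. frechet_derivative f (at z) v) (at u) w \<bullet> b
      = frechet_derivative (\<lambda>z. frechet_derivative f (at z) w) (at u) v \<bullet> b"
    using mixed_partials_real[OF S smooth_on_linear[OF bounded_linear_inner_left S(1) f], of b v w]
      *[of v w] *[of w v] by simp
qed

section \<open>The bilinear form\<close>

lemma bounded_bilinear_bil: "bounded_bilinear bil"
  by (simp add: bilinear_conv_bounded_bilinear[symmetric] bilinear_def linear_iff bil_def algebra_simps)

lemmas bil_add_left = bounded_bilinear.add_left[OF bounded_bilinear_bil]
lemmas bil_add_right = bounded_bilinear.add_right[OF bounded_bilinear_bil]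
lemmas bil_diff_left = bounded_bilinear.diff_left[OF bounded_bilinear_bil]
lemmas bil_diff_right = bounded_bilinear.diff_right[OF bounded_bilinear_bil]
lemmas bil_scale_left = bounded_bilinear.scaleR_left[OF bounded_bilinear_bil, simplified]
lemmas bil_scale_right = bounded_bilinear.scaleR_right[OF bounded_bilinear_bil, simplified]
lemmas bil_zero_left = bounded_bilinear.zero_left[OF bounded_bilinear_bil]
lemmas bil_zero_right = bounded_bilinear.zero_right[OF bounded_bilinear_bil]
lemmas bil_simps = bil_add_left bil_add_right bil_diff_left bil_diff_right
  bil_scale_left bil_scale_right bil_zero_left bil_zero_right

lemma bil_commute: "bil z w = bil w z"
  by (simp add: bil_def)

text \<open>Pairing \<open>x\<close> with each standard basis vector returns a nonzero multiple of a
  different coordinate of \<open>x\<close>.\<close>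

lemma bil_nondegenerate:
  assumes "\<And>w. bil x w = 0"
  shows "x = 0"
  using assms[of "axis 0 1"] assms[of "axis 1 1"] assms[of "axis 2 1"] assms[of "axis 3 1"] assms[of "axis 4 1"]
  by (simp add: bil_def axis_def vec5_eq_iff)

lemma bil_span_eq_0: "y \<in> span S \<Longrightarrow> (\<And>s. s \<in> S \<Longrightarrow> bil c s = 0) \<Longrightarrow> bil c y = 0"
  by (induction rule: span_induct_alt) (simp_all add: bil_simps)

text \<open>If \<open>w\<close> were not a multiple of \<open>x\<close>, then \<open>x, w, a, b, n\<close> would be a basis of \<open>V\<close> all of whose
  members are orthogonal to \<open>x\<close>.\<close>

lemma orthogonal_frame_imp_span:
  assumes x: "x \<noteq> 0" "bil x x = 0" "bil x a = 0" "bil x b = 0" "bil x n = 0"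
    and ab: "bil a a = 0" "bil b b = 0" "bil a b \<noteq> 0"
    and n: "bil n a = 0" "bil n b = 0" "bil n n \<noteq> 0"
    and w: "bil w x = 0" "bil w a = 0" "bil w b = 0" "bil w n = 0"
  shows "w \<in> span {x}"
proof (rule ccontr)
  assume nw: "w \<notin> span {x}"
  have i1: "independent {w, x}" using nw x(1) by (auto simp: independent_insert)
  have c: "bil a x = 0" "bil b x = 0" "bil n x = 0" "bil x w = 0" "bil a w = 0" "bil b w = 0" "bil n w = 0"
    using x w by (simp_all add: bil_commute)
  \<comment> \<open>Each new vector is separated from the preceding span by a vector orthogonal to
    that span: \<open>b\<close> detects \<open>a\<close>, \<open>a\<close> detects \<open>b\<close>,
    and \<open>n\<close> detects itself.\<close>
  have a: "a \<notin> span {w, x}"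
  proof
    assume "a \<in> span {w, x}"
    from bil_span_eq_0[OF this, of b] show False using c ab(3) bil_commute[of a b] by auto
  qed
  have b: "b \<notin> span {a, w, x}"
  proof
    assume "b \<in> span {a, w, x}"
    from bil_span_eq_0[OF this, of a] show False using c ab by auto
  qed
  have nn: "n \<notin> span {b, a, w, x}"
  proof
    assume "n \<in> span {b, a, w, x}"
    from bil_span_eq_0[OF this, of n] show False using c n by auto
  qed
  have ne: "w \<noteq> x" "a \<notin> {w, x}" "b \<notin> {a, w, x}" "n \<notin> {b, a, w, x}"
    using nw a b nn by (auto intro: span_base)
  have ind: "independent {n, b, a, w, x}"
    using i1 a b nn by (simp add: independent_insertI)
  have card: "card {n, b, a, w, x} = 5" using ne by simp
  have "UNIV \<subseteq> span {n, b, a, w, x}"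
    by (rule card_ge_dim_independent[OF _ ind]) (use card in \<open>simp_all add: dim_UNIV\<close>)
  then have "bil x y = 0" for y
    using bil_span_eq_0[of y "{n, b, a, w, x}" x] x c(4) by blast
  then show False using bil_nondegenerate x(1) by blast
qed

text \<open>The product rule for a constant pairing. The orthogonality relations among a lift, its
  normal field and their derivatives are all obtained from it.\<close>

lemma bil_const_derivative:
  assumes D: "open D" "u \<in> D" and f: "smooth_on D f" and g: "smooth_on D g"
    and c: "\<And>z. z \<in> D \<Longrightarrow> bil (f z) (g z) = c"
  shows "bil (f u) (frechet_derivative g (at u) v) + bil (frechet_derivative f (at u) v) (g u) = 0"
proof -
  have "((\<lambda>z. bil (f z) (g z)) has_derivative
      (\<lambda>v. bil (f u) (frechet_derivative g (at u) v) + bil (frechet_derivative f (at u) v) (g u))) (at u)"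
    by (rule bounded_bilinear.FDERIV[OF bounded_bilinear_bil smooth_on_has_derivative[OF f D(2)]
          smooth_on_has_derivative[OF g D(2)]])
  then have "((\<lambda>z. c) has_derivative
      (\<lambda>v. bil (f u) (frechet_derivative g (at u) v) + bil (frechet_derivative f (at u) v) (g u))) (at u)"
    by (rule has_derivative_transform_within_open[OF _ D]) (rule c)
  from has_derivative_unique[OF this has_derivative_const] show ?thesis by metis
qed

section \<open>Points of the quadric\<close>

lemma ppoint_eq_imp_scale:
  assumes "ppoint z = ppoint w" "z \<noteq> 0"
  shows "\<exists>c. c \<noteq> 0 \<and> z = c *\<^sub>R w"
proof -
  have "z \<in> span {w}" using assms by (metis ppoint_def span_base singletonI)
  then obtain c where "z = c *\<^sub>R w" by (auto simp: span_singleton)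
  then show ?thesis using assms(2) by (metis scaleR_eq_0_iff)
qed

lemma ppoint_in_quadric:
  assumes "z \<noteq> 0"
  shows "ppoint z \<in> quadric \<longleftrightarrow> bil z z = 0"
proof
  assume "ppoint z \<in> quadric"
  then obtain w where w: "ppoint z = ppoint w" "bil w w = 0" by (auto simp: quadric_def)
  then obtain c where "z = c *\<^sub>R w" using ppoint_eq_imp_scale assms by blast
  then show "bil z z = 0" using w by (simp add: bil_simps)
qed (use assms in \<open>auto simp: quadric_def\<close>)

lemma ppoint_in_sphere_of:
  assumes "z \<noteq> 0"
  shows "ppoint z \<in> sphere_of m \<longleftrightarrow> bil m z = 0 \<and> bil z z = 0"
proof -
  have "ppoint z \<in> ppoint ` {w. w \<noteq> 0 \<and> bil m w = 0} \<longleftrightarrow> bil m z = 0"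
  proof
    assume "ppoint z \<in> ppoint ` {w. w \<noteq> 0 \<and> bil m w = 0}"
    then obtain w where w: "ppoint z = ppoint w" "bil m w = 0" by auto
    then obtain c where "z = c *\<^sub>R w" using ppoint_eq_imp_scale assms by blast
    then show "bil m z = 0" using w by (simp add: bil_simps)
  qed (use assms in auto)
  then show ?thesis by (simp add: sphere_of_def ppoint_in_quadric[OF assms])
qed

lemma sphere_of_scale: "c \<noteq> 0 \<Longrightarrow> sphere_of (c *\<^sub>R z) = sphere_of z"
  by (simp add: sphere_of_def bil_simps)

text \<open>The cone over \<open>W\<close> is the union of its nonzero dilates, each of which is
  open.\<close>

lemma openin_ppoint_image:
  assumes "open W" "0 \<notin> W"
  shows "openin PV_top (ppoint ` W)"
proof -
  have "{z. z \<noteq> 0 \<and> ppoint z \<in> ppoint ` W} = (\<Union>c\<in>-{0}. (*\<^sub>R) c ` W)" (is "?L = ?R")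
  proof (rule set_eqI)
    fix z
    show "z \<in> ?L \<longleftrightarrow> z \<in> ?R"
    proof
      assume z: "z \<in> ?L"
      then obtain w where "w \<in> W" "ppoint z = ppoint w" by blast
      moreover from this obtain c where "c \<noteq> 0" "z = c *\<^sub>R w" using ppoint_eq_imp_scale z by blast
      ultimately show "z \<in> ?R" by blast
    next
      assume "z \<in> ?R"
      then obtain c w where "c \<noteq> 0" "w \<in> W" "z = c *\<^sub>R w" by blast
      then show "z \<in> ?L" using assms(2) ppoint_scale[of c w] by auto
    qed
  qed
  moreover have "open (\<Union>c\<in>-{0}. (*\<^sub>R) c ` W)"
    by (intro open_UN ballI open_scaling assms(1)) simp
  ultimately show ?thesis using assms(2) by (auto simp: openin_PV_top PV_def)
qed

section \<open>Local parametrizations\<close>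

lemma local_paramD:
  assumes "local_param M D x"
  shows "open D" "smooth_on D x" "u \<in> D \<Longrightarrow> x u \<noteq> 0"
    "u \<in> D \<Longrightarrow> v \<noteq> 0 \<Longrightarrow> frechet_derivative x (at u) v \<notin> span {x u}"
    "openin (subtopology PV_top M) ((ppoint \<circ> x) ` D)"
    "embedding_map (top_of_set D) PV_top (ppoint \<circ> x)"
  using assms by (auto simp: local_param_def)

lemma local_param_inj: "local_param M D x \<Longrightarrow> inj_on (ppoint \<circ> x) D"
  using local_paramD(6)[of M D x] homeomorphic_imp_injective_map[of "top_of_set D" _ "ppoint \<circ> x"]
  by (simp add: embedding_map_def)

lemma local_param_image_subset: "local_param M D x \<Longrightarrow> (ppoint \<circ> x) ` D \<subseteq> M"
  using local_paramD(5) openin_imp_subset by metis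

lemma local_param_openin_image:
  assumes M: "local_param M D x" and E: "open E" "E \<subseteq> D"
  shows "openin (subtopology PV_top M) ((ppoint \<circ> x) ` E)"
proof -
  have "homeomorphic_map (top_of_set D) (subtopology PV_top ((ppoint \<circ> x) ` D)) (ppoint \<circ> x)"
    using local_paramD(6)[OF M] by (simp add: embedding_map_def)
  then have "openin (subtopology PV_top ((ppoint \<circ> x) ` D)) ((ppoint \<circ> x) ` E)"
    using E by (meson homeomorphic_imp_open_map open_map_def open_subset)
  then show ?thesis
    using local_paramD(5)[OF M] local_param_image_subset[OF M]
    by (metis inf.absorb_iff2 openin_trans_full subtopology_subtopology)
qed

lemma local_param_open_vimage:
  assumes M: "local_param M D x" and U: "openin (subtopology PV_top M) U"
  shows "open {u \<in> D. ppoint (x u) \<in> U}"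
proof -
  have "continuous_map (top_of_set D) (subtopology PV_top M) (ppoint \<circ> x)"
    using homeomorphic_imp_continuous_map[of "top_of_set D"
        "subtopology PV_top ((ppoint \<circ> x) ` D)" "ppoint \<circ> x"] local_paramD(6)[OF M]
      local_param_image_subset[OF M]
    by (auto simp: embedding_map_def continuous_map_in_subtopology)
  from openin_continuous_map_preimage[OF this U] show ?thesis
    using local_paramD(1)[OF M] by (simp add: openin_open_eq)
qed

text \<open>Used to shrink charts to balls with a constant pole, to pieces lying in two spheres, and
  to domains of smooth null frames.\<close>

lemma local_param_subset:
  assumes M: "local_param M D x" and E: "open E" "E \<subseteq> D"
  shows "local_param M E x"
proof -
  let ?F = "ppoint \<circ> x"
  have h: "homeomorphic_map (top_of_set D) (subtopology PV_top (?F ` D)) ?F"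
    using local_paramD(6)[OF M] by (simp add: embedding_map_def)
  have im: "?F ` E \<subseteq> ?F ` D" using E(2) by blast
  then have "?F ` (topspace (top_of_set D) \<inter> E) = topspace (subtopology PV_top (?F ` D)) \<inter> ?F ` E"
    using homeomorphic_imp_surjective_map[OF h] E(2) by (simp add: Int_absorb1)
  from homeomorphic_map_subtopologies[OF h this]
  have "embedding_map (subtopology (top_of_set D) E) PV_top ?F"
    using E(2) im by (simp add: embedding_map_def subtopology_subtopology Int_absorb1)
  moreover have "subtopology (top_of_set D) E = top_of_set E"
    using E by (simp add: subtopology_subtopology inf.absorb2)
  ultimately show ?thesis
    using M E local_param_openin_image[OF M E] smooth_on_subset[of D x E]
    by (auto simp: local_param_def)
qed

lemma local_param_null:
  assumes "local_param M D x" "M \<subseteq> quadric" "u \<in> D"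
  shows "bil (x u) (x u) = 0"
  using local_param_image_subset[OF assms(1)] assms ppoint_in_quadric local_paramD(3)[OF assms(1,3)]
  by fastforce

section \<open>Null directions\<close>

lemma real2_in_span:
  fixes v a b :: "real^2"
  assumes "independent {a, b}" "a \<noteq> b"
  shows "v \<in> span {a, b}"
proof -
  have "UNIV \<subseteq> span {a, b}"
    by (rule card_ge_dim_independent[OF _ assms(1)]) (use assms(2) in \<open>simp_all add: dim_UNIV\<close>)
  then show ?thesis by blast
qed

text \<open>If the pairing vanished, \<open>a + b\<close> would be null as well and would span a
  third null line.\<close>

lemma null_lines_frame:
  assumes lin: "linear (frechet_derivative x (at u))" and card: "card (null_lines x u) = 2"
    and ind: "independent {a, b}" "a \<noteq> b"
    and null: "induced_form x u a a = 0" "induced_form x u b b = 0"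
  shows "induced_form x u a b \<noteq> 0"
proof
  assume 0: "induced_form x u a b = 0"
  note L = linear_add[OF lin]
  have "induced_form x u (a + b) (a + b) = 0"
    using 0 null by (simp add: induced_form_def L bil_simps bil_commute[of "frechet_derivative x (at u) b" "frechet_derivative x (at u) a"])
  moreover have ab: "a \<notin> span {b}" "b \<notin> span {a}"
    using ind independent_insert[of a "{b}"] independent_insert[of b "{a}"] by (auto simp: insert_commute)
  moreover have nz: "a \<noteq> 0" "b \<noteq> 0"
    using ab span_zero[of "{a}"] span_zero[of "{b}"] by auto
  moreover have "a + b \<noteq> 0"
    using ab(1) span_neg[of b "{b}"] by (auto simp: add_eq_0_iff2 span_base)
  ultimately have "span {a} \<in> null_lines x u" "span {b} \<in> null_lines x u" "span {a + b} \<in> null_lines x u"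
    using null by (auto simp: null_lines_def)
  moreover have "span {a} \<noteq> span {b}" using ab(1) span_base[of a "{a}"] by auto
  moreover have "span {a + b} \<noteq> span {a}"
  proof
    assume "span {a + b} = span {a}"
    then have "a + b \<in> span {a}" using span_base[of "a + b" "{a + b}"] by simp
    then show False using ab(2) span_add_eq[OF span_base[OF insertI1[of a "{}"]], of b] by blast
  qed
  moreover have "span {a + b} \<noteq> span {b}"
  proof
    assume "span {a + b} = span {b}"
    then have "a + b \<in> span {b}" using span_base[of "a + b" "{a + b}"] by simp
    then show False using ab(1) span_add_eq2[OF span_base[OF insertI1[of b "{}"]], of a] by blast
  qed
  ultimately have "card {span {a}, span {b}, span {a + b}} = 3" "{span {a}, span {b}, span {a + b}} \<subseteq> null_lines x u"
    by auto
  \<comment> \<open>An infinite set has \<open>card\<close> 0, so cardinality 2 yields the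
    finiteness that \<open>card_mono\<close> requires.\<close>
  moreover have "finite (null_lines x u)" using card by (metis card.infinite zero_neq_numeral)
  ultimately show False using card card_mono[of "null_lines x u" "{span {a}, span {b}, span {a + b}}"] by simp
qed

text \<open>Generators of the two null lines at a single point. They suffice for pointwise
  orthogonality arguments, where smooth dependence on \<open>u\<close> is irrelevant.\<close>

lemma null_lines_obtain_frame:
  assumes lin: "linear (frechet_derivative x (at u))" and card: "card (null_lines x u) = 2"
  obtains a b where "induced_form x u a a = 0" "induced_form x u b b = 0" "induced_form x u a b \<noteq> 0"
proof -
  obtain A B where AB: "null_lines x u = {A, B}" "A \<noteq> B" using card by (auto simp: card_2_iff)
  then have "A \<in> null_lines x u" "B \<in> null_lines x u" by auto
  then obtain a b where a: "A = span {a}" "a \<noteq> 0" "induced_form x u a a = 0"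
    and b: "B = span {b}" "b \<noteq> 0" "induced_form x u b b = 0"
    by (auto simp: null_lines_def)
  have "a \<notin> span {b}"
  proof
    assume "a \<in> span {b}"
    then obtain c where "a = c *\<^sub>R b" by (auto simp: span_singleton)
    then have "span {a} = span {b}" using a(2) span_image_scale[of "{b}" "\<lambda>_. c"] by auto
    then show False using AB a b by simp
  qed
  then have "a \<noteq> b" "independent {a, b}"
    using b(2) by (auto simp: independent_insert intro: span_base)
  then show thesis using that null_lines_frame[OF lin card] a b by blast
qed

section \<open>Two-isotropic surfaces are locally spherical\<close>

lemma two_isotropic_locally_spherical:
  fixes x n :: "real^2 \<Rightarrow> real^5"
  assumes D: "open D" and x: "smooth_on D x" "\<And>u. u \<in> D \<Longrightarrow> x u \<noteq> 0"
    and imm: "\<And>u v. u \<in> D \<Longrightarrow> v \<noteq> 0 \<Longrightarrow> frechet_derivative x (at u) v \<notin> span {x u}"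
    and null: "\<And>u. u \<in> D \<Longrightarrow> bil (x u) (x u) = 0"
    and N: "null_frame D x N1 N2" "\<And>u. u \<in> D \<Longrightarrow> induced_form x u (N1 u) (N2 u) \<noteq> 0"
    and n: "normal_field D x n"
    and ell: "\<And>u. u \<in> D \<Longrightarrow> ell x N1 n u = 0" "\<And>u. u \<in> D \<Longrightarrow> ell x N2 n u = 0"
    and u0: "u0 \<in> D"
  obtains e m where "e > 0" "ball u0 e \<subseteq> D" "bil m m = -2" "\<And>u. u \<in> ball u0 e \<Longrightarrow> bil m (x u) = 0"
proof -
  have sN: "smooth_on D N1" "smooth_on D N2" and sn: "smooth_on D n"
    using N(1) n by (auto simp: null_frame_def normal_field_def)
  have Nnull: "bil (along N1 x u) (along N1 x u) = 0" "bil (along N2 x u) (along N2 x u) = 0"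
    "bil (along N1 x u) (along N2 x u) \<noteq> 0" if "u \<in> D" for u
    using N that by (auto simp: null_frame_def induced_form_def along_def)
  have nn: "bil (n u) (n u) = -2" "bil (n u) (x u) = 0"
    "bil (n u) (frechet_derivative x (at u) v) = 0" if "u \<in> D" for u v
    using n that by (auto simp: normal_field_def)
  define p where "p u = bil (along N1 x u) (along N2 x u)" for u
  \<comment> \<open>The multiplier is chosen so that the derivative of \<open>m\<close> along
    \<open>N1\<close> becomes orthogonal to the derivative of \<open>x\<close> along
    \<open>N2\<close>.\<close>
  define l where "l u = - (bil (along N1 n u) (along N2 x u) * inverse (p u))" for u
  define m where "m u = n u + l u *\<^sub>R x u" for u
  note s_bil = smooth_on_bilinear[OF bounded_bilinear_bil D]
  have sp: "smooth_on D p"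
    unfolding p_def by (rule s_bil[OF smooth_on_along[OF D sN(1) x(1)] smooth_on_along[OF D sN(2) x(1)]])
  have p0: "p u \<noteq> 0" if "u \<in> D" for u using Nnull(3)[OF that] by (simp add: p_def)
  have sl: "smooth_on D l"
    unfolding l_def
    by (rule smooth_on_minus[OF D smooth_on_mult[OF D s_bil[OF smooth_on_along[OF D sN(1) sn]
              smooth_on_along[OF D sN(2) x(1)]] smooth_on_inverse[OF D p0 sp]]])
  have slx: "smooth_on D (\<lambda>u. l u *\<^sub>R x u)" by (rule smooth_on_scaleR[OF D sl x(1)])
  have sm: "smooth_on D m" unfolding m_def by (rule smooth_on_add[OF D sn slx])
  let ?x = "\<lambda>u. frechet_derivative x (at u)" and ?n = "\<lambda>u. frechet_derivative n (at u)"
    and ?m = "\<lambda>u. frechet_derivative m (at u)" and ?l = "\<lambda>u. frechet_derivative l (at u)"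
  have m': "?m u v = ?n u v + (l u *\<^sub>R ?x u v + ?l u v *\<^sub>R x u)" if "u \<in> D" for u v
  proof -
    have "(m has_derivative (\<lambda>v. ?n u v + (l u *\<^sub>R ?x u v + ?l u v *\<^sub>R x u))) (at u)"
      unfolding m_def
      by (rule has_derivative_add[OF smooth_on_has_derivative[OF sn that]
            has_derivative_scaleR[OF smooth_on_has_derivative[OF sl that] smooth_on_has_derivative[OF x(1) that]]])
    from fun_cong[OF frechet_derivative_at[OF this]] show ?thesis by metis
  qed
  have xx: "bil (x u) (?x u v) = 0" if "u \<in> D" for u v
    using bil_const_derivative[OF D that x(1) x(1) null, of v] by (simp add: bil_commute)
  have nx: "bil (?n u v) (x u) = 0" if "u \<in> D" for u v
    using bil_const_derivative[OF D that sn x(1) nn(2), of v] nn(3)[OF that] by simp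
  have nn': "bil (?n u v) (n u) = 0" if "u \<in> D" for u v
    using bil_const_derivative[OF D that sn sn nn(1), of v] by (simp add: bil_commute)
  \<comment> \<open>Differentiating \<open>bil n (dx v) = 0\<close> along \<open>w\<close> expresses
    this pairing as minus that of \<open>n\<close> with a second derivative of \<open>x\<close>,
    which is symmetric in \<open>v\<close> and \<open>w\<close>.\<close>
  have sym: "bil (?n u v) (?x u w) = bil (?n u w) (?x u v)" if "u \<in> D" for u v w
    using bil_const_derivative[OF D that sn smooth_on_derivative[OF x(1)] nn(3), of v w]
      bil_const_derivative[OF D that sn smooth_on_derivative[OF x(1)] nn(3), of w v]
      mixed_partials[OF D that x(1), of v w] by simp
  \<comment> \<open>Differentiating \<open>bil n (along K x) = 0\<close> along \<open>K\<close>
    identifies the left side with \<open>- ell x K n u\<close>.\<close>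
  have nN: "bil (?n u (K u)) (?x u (K u)) = 0"
    if "u \<in> D" "smooth_on D K" "ell x K n u = 0" for u K
    using bil_const_derivative[OF D that(1) sn smooth_on_along[OF D that(2) x(1)], where c = 0 and v = "K u"] nn(3) that(3)
    by (simp add: along_def ell_def bil_commute)
  \<comment> \<open>Both derivatives are orthogonal to \<open>x\<close>, \<open>n\<close> and the
    two null tangent vectors, so \<open>orthogonal_frame_imp_span\<close> leaves only multiples of
    \<open>x\<close>.\<close>
  have m_span_frame: "?m u (N1 u) \<in> span {x u}" "?m u (N2 u) \<in> span {x u}" if u: "u \<in> D" for u
  proof -
    have c: "bil (x u) (n u) = 0" "bil (?x u v) (n u) = 0" "bil (?x u v) (x u) = 0" for v
      using nn(2,3)[OF u] xx[OF u] bil_commute[of "x u" "n u"] bil_commute[of "?x u v" "n u"]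
        bil_commute[of "?x u v" "x u"] by simp_all
    have *: "?m u v \<in> span {x u}"
      if "bil (?m u v) (?x u (N1 u)) = 0" "bil (?m u v) (?x u (N2 u)) = 0" for v
    proof (rule orthogonal_frame_imp_span[OF x(2)[OF u] null[OF u], of "?x u (N1 u)" "?x u (N2 u)" "n u"])
      show "bil (?m u v) (x u) = 0" "bil (?m u v) (n u) = 0"
        using nx[OF u] nn'[OF u] c null[OF u] by (simp_all add: m'[OF u] bil_simps)
    qed (use that Nnull[OF u] nn[OF u] xx[OF u] c in \<open>simp_all add: along_def\<close>)
    have "bil (?n u (N1 u)) (?x u (N2 u)) + l u * bil (?x u (N1 u)) (?x u (N2 u)) = 0"
      using Nnull(3)[OF u] by (simp add: l_def p_def along_def)
    \<comment> \<open>Symmetry of the second fundamental form makes the same multiplier work for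
      \<open>N2\<close>.\<close>
    moreover from this have "bil (?n u (N2 u)) (?x u (N1 u)) + l u * bil (?x u (N2 u)) (?x u (N1 u)) = 0"
      using sym[OF u, of "N1 u" "N2 u"] bil_commute[of "?x u (N2 u)" "?x u (N1 u)"] by simp
    ultimately show "?m u (N1 u) \<in> span {x u}" "?m u (N2 u) \<in> span {x u}"
      using nN[OF u sN(1) ell(1)[OF u]] nN[OF u sN(2) ell(2)[OF u]] Nnull[OF u] xx[OF u]
      by - (rule *; simp add: m'[OF u] bil_simps along_def)+
  qed
  have m_span: "?m u v \<in> span {x u}" if u: "u \<in> D" for u v
  proof -
    have "independent {N1 u, N2 u}" "N1 u \<noteq> N2 u" using N(1) u by (auto simp: null_frame_def)
    then have v: "v \<in> span {N1 u, N2 u}" by (rule real2_in_span)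
    have sub: "subspace {v. ?m u v \<in> span {x u}}"
      using linear_subspace_vimage[OF smooth_on_linear_derivative[OF sm u] subspace_span, of "{x u}"]
      by (simp add: vimage_def)
    have "{N1 u, N2 u} \<subseteq> {v. ?m u v \<in> span {x u}}" using m_span_frame[OF u] by simp
    from subsetD[OF span_minimal[OF this sub] v] show ?thesis by simp
  qed
  \<comment> \<open>The coefficient of \<open>x\<close> is extracted with the Euclidean inner
    product, because \<open>bil (x u) (x u) = 0\<close>. The formula also shows that it is smooth in
    \<open>u\<close>.\<close>
  define b where "b v u = (?m u v \<bullet> x u) * inverse (x u \<bullet> x u)" for v u
  have b: "?m u v = b v u *\<^sub>R x u" if u: "u \<in> D" for u v
    using m_span[OF u, of v] x(2)[OF u] by (auto simp: span_singleton b_def)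
  have sb: "smooth_on D (b v)" for v
    unfolding b_def
    by (rule smooth_on_mult[OF D smooth_on_bilinear[OF bounded_bilinear_inner D smooth_on_derivative[OF sm] x(1)]
          smooth_on_inverse[OF D _ smooth_on_bilinear[OF bounded_bilinear_inner D x(1) x(1)]]])
      (use x(2) in simp)
  text \<open>Differentiating \<open>dm = \<beta> x\<close> once more gives \<open>\<beta> \<and> dx = 0\<close> modulo \<open>x\<close>, and \<open>x\<close> is an immersion.\<close>
  have b0: "b (axis 1 1) u = 0 \<and> b (axis 2 1) u = 0" if u: "u \<in> D" for u
  proof -
    have db: "frechet_derivative (\<lambda>z. ?m z v) (at u) w = b v u *\<^sub>R ?x u w + frechet_derivative (b v) (at u) w *\<^sub>R x u"
      for v w
    proof -
      have "((\<lambda>z. b v z *\<^sub>R x z) has_derivative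
          (\<lambda>w. b v u *\<^sub>R ?x u w + frechet_derivative (b v) (at u) w *\<^sub>R x u)) (at u)"
        by (rule has_derivative_scaleR[OF smooth_on_has_derivative[OF sb u] smooth_on_has_derivative[OF x(1) u]])
      then have "((\<lambda>z. ?m z v) has_derivative
          (\<lambda>w. b v u *\<^sub>R ?x u w + frechet_derivative (b v) (at u) w *\<^sub>R x u)) (at u)"
        by (rule has_derivative_transform_within_open[OF _ D u]) (simp add: b)
      from fun_cong[OF frechet_derivative_at[OF this]] show ?thesis by metis
    qed
    let ?e = "axis 1 1 :: real^2" and ?f = "axis 2 1 :: real^2"
    let ?v = "b ?e u *\<^sub>R ?f - b ?f u *\<^sub>R ?e"
    note lin = smooth_on_linear_derivative[OF x(1) u]
    have "?x u ?v = b ?e u *\<^sub>R ?x u ?f - b ?f u *\<^sub>R ?x u ?e"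
      by (simp only: linear_diff[OF lin] linear_scale[OF lin])
    also have "\<dots> = (frechet_derivative (b ?f) (at u) ?e - frechet_derivative (b ?e) (at u) ?f) *\<^sub>R x u"
      using mixed_partials[OF D u sm, of ?e ?f] unfolding db by (simp add: algebra_simps)
    finally have "?x u ?v \<in> span {x u}" by (simp add: span_base span_scale)
    then have "?v = 0" using imm[OF u] by blast
    then show ?thesis by (simp add: vec_eq_iff forall_2 axis_def)
  qed
  have m0: "?m u = (\<lambda>v. 0)" if u: "u \<in> D" for u
  proof
    fix v show "?m u v = 0"
      using linear_real2_expand[OF smooth_on_linear_derivative[OF sm u], of v] b[OF u] b0[OF u] by simp
  qed
  \<comment> \<open>\<open>D\<close> may be disconnected; on a ball, which is convex, zero
    derivative implies constancy.\<close>
  obtain e where e: "e > 0" "ball u0 e \<subseteq> D" using D u0 openE by blast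
  have "(m has_derivative (\<lambda>v. 0)) (at u within ball u0 e)" if "u \<in> ball u0 e" for u
  proof -
    have u: "u \<in> D" using that e by blast
    show ?thesis using has_derivative_at_withinI[OF smooth_on_has_derivative[OF sm u]] m0[OF u] by simp
  qed
  from has_derivative_zero_constant[OF convex_ball this] obtain c where c: "\<And>u. u \<in> ball u0 e \<Longrightarrow> m u = c"
    by blast
  show thesis
  proof (rule that[OF e])
    have "c = m u0" using c e by simp
    then show "bil c c = -2"
      using nn(1,2)[OF u0] null[OF u0] bil_commute[of "x u0" "n u0"] by (simp add: m_def bil_simps)
    fix u assume u: "u \<in> ball u0 e"
    then have "c = m u" "u \<in> D" using c e by auto
    then show "bil c (x u) = 0" using nn(2)[of u] null[of u] by (simp add: m_def bil_simps)
  qed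
qed

section \<open>The sphere containing a surface\<close>

lemma sphere_of_unique:
  assumes E: "open E" "E \<noteq> {}" and x: "smooth_on E x" "\<And>u. u \<in> E \<Longrightarrow> x u \<noteq> 0"
    and inj: "inj_on (ppoint \<circ> x) E"
    and null: "\<And>u. u \<in> E \<Longrightarrow> bil (x u) (x u) = 0"
    and card: "\<And>u. u \<in> E \<Longrightarrow> card (null_lines x u) = 2"
    and m: "bil m m < 0" "\<And>u. u \<in> E \<Longrightarrow> bil m (x u) = 0"
    and m': "bil m' m' < 0" "\<And>u. u \<in> E \<Longrightarrow> bil m' (x u) = 0"
  shows "sphere_of m = sphere_of m'"
proof -
  \<comment> \<open>The coefficient that makes \<open>m' - c m\<close> orthogonal to
    \<open>m\<close>.\<close>
  define c where "c = bil m' m / bil m m"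
  define w where "w = m' - c *\<^sub>R m"
  have wm: "bil w m = 0" using m(1) by (simp add: w_def c_def bil_simps)
  have d: "bil k (frechet_derivative x (at u) v) = 0"
    if "\<And>u. u \<in> E \<Longrightarrow> bil k (x u) = 0" "u \<in> E" for k u v
    using bil_const_derivative[OF E(1) that(2) smooth_on_const[OF E(1)] x(1) that(1), where v = v]
    by (simp add: bil_simps frechet_derivative_const)
  have w: "w \<in> span {x u}" if u: "u \<in> E" for u
  proof -
    obtain a b where ab: "induced_form x u a a = 0" "induced_form x u b b = 0" "induced_form x u a b \<noteq> 0"
      using null_lines_obtain_frame[OF smooth_on_linear_derivative[OF x(1) u] card[OF u]] .
    have xx: "bil (x u) (frechet_derivative x (at u) v) = 0" for v
      using bil_const_derivative[OF E(1) u x(1) x(1) null, of v] by (simp add: bil_commute)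
    show ?thesis
    proof (rule orthogonal_frame_imp_span[OF x(2)[OF u] null[OF u] xx xx _ ab[unfolded induced_form_def]])
      show "bil (x u) m = 0" using m(2)[OF u] by (simp add: bil_commute)
      show "bil m m \<noteq> 0" using m(1) by simp
      show "bil w (x u) = 0" using m(2)[OF u] m'(2)[OF u] by (simp add: w_def bil_simps)
    qed (use wm d[OF m(2) u] d[OF m'(2) u] in \<open>simp_all add: w_def bil_simps\<close>)
  qed
  \<comment> \<open>A nonzero \<open>w\<close> on the line of every \<open>x u\<close> would map all
    of \<open>E\<close> to one projective point. By injectivity \<open>E\<close> would then be a
    singleton, which is not open.\<close>
  have "w = 0"
  proof (rule ccontr)
    assume "w \<noteq> 0"
    have "ppoint (x u) = ppoint w" if u: "u \<in> E" for u
    proof -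
      obtain k where "w = k *\<^sub>R x u" using w[OF u] by (auto simp: span_singleton)
      then show ?thesis using \<open>w \<noteq> 0\<close> ppoint_scale[of k "x u"] by auto
    qed
    moreover obtain u where "u \<in> E" using E by blast
    ultimately have "E = {u}" using inj by (auto simp: inj_on_def)
    then show False using E(1) not_open_singleton by blast
  qed
  then have "m' = c *\<^sub>R m" by (simp add: w_def)
  moreover from this have "c \<noteq> 0" using m'(1) by (auto simp: bil_simps)
  ultimately show ?thesis by (simp add: sphere_of_scale)
qed

section \<open>Openness of a surface in the sphere containing it\<close>

text \<open>A vector pairing nontrivially with \<open>x\<close> exists by nondegeneracy. It is first
  projected off \<open>m\<close> and then corrected by a multiple of \<open>x\<close>; since
  \<open>x\<close> is null and orthogonal to \<open>m\<close>, the correction keeps the pairings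
  with \<open>x\<close> and \<open>m\<close>.\<close>

lemma null_vector_orthogonal_to:
  assumes m: "bil m m < 0" and x: "x \<noteq> 0" "bil x x = 0" "bil m x = 0"
  obtains y where "bil y y = 0" "bil y m = 0" "bil y x \<noteq> 0"
proof -
  obtain y0 where y0: "bil y0 x \<noteq> 0" using bil_nondegenerate[of x] x(1) by (metis bil_commute)
  define y1 where "y1 = y0 - (bil y0 m / bil m m) *\<^sub>R m"
  have y1: "bil y1 m = 0" "bil y1 x \<noteq> 0"
    using m x y0 by (simp_all add: y1_def bil_simps)
  \<comment> \<open>The coefficient solves \<open>bil y y = 0\<close>, which is linear in it because
    \<open>x\<close> is null.\<close>
  define y where "y = y1 - (bil y1 y1 / (2 * bil y1 x)) *\<^sub>R x"
  show thesis
  proof (rule that)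
    show "bil y m = 0" using y1 x(3) by (simp add: y_def bil_simps bil_commute[of x m])
    show "bil y x \<noteq> 0" using y1 x by (simp add: y_def bil_simps)
    show "bil y y = 0" using y1 x(2) by (simp add: y_def bil_simps bil_commute[of x y1])
  qed
qed

text \<open>The map \<open>(u, r, s, t) \<mapsto> r x(u) + s m + t y\<close> is injective near \<open>(u\<^sub>0, 1, 0, 0)\<close>, hence open by invariance of
  domain; by the choice of \<open>y\<close> it meets the cone over the sphere only in multiples of \<open>x(u)\<close>.\<close>

lemma parametrized_open_in_sphere:
  fixes x :: "real^2 \<Rightarrow> real^5"
  assumes D: "open D" and x: "continuous_on D x" "\<And>u. u \<in> D \<Longrightarrow> x u \<noteq> 0"
    and inj: "inj_on (ppoint \<circ> x) D"
    and null: "\<And>u. u \<in> D \<Longrightarrow> bil (x u) (x u) = 0"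
    and m: "bil m m < 0" "\<And>u. u \<in> D \<Longrightarrow> bil m (x u) = 0"
    and u0: "u0 \<in> D"
  shows "\<exists>T. openin PV_top T \<and> ppoint (x u0) \<in> T \<and> T \<inter> sphere_of m \<subseteq> (ppoint \<circ> x) ` D"
proof -
  obtain y where y: "bil y y = 0" "bil y m = 0" "bil y (x u0) \<noteq> 0"
    using null_vector_orthogonal_to[OF m(1) x(2)[OF u0] null[OF u0] m(2)[OF u0]] .
  define E where "E = {u \<in> D. bil y (x u) \<noteq> 0}"
  have "continuous_on D (\<lambda>u. bil y (x u))"
    by (rule bounded_bilinear.continuous_on[OF bounded_bilinear_bil continuous_on_const x(1)])
  then have "open (D \<inter> (\<lambda>u. bil y (x u)) -` (-{0}))"
    using D by (simp add: continuous_on_open_vimage[OF D] Int_commute open_Compl)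
  moreover have "E = D \<inter> (\<lambda>u. bil y (x u)) -` (-{0})" by (auto simp: E_def)
  ultimately have E: "open E" by simp
  have ED: "u \<in> D" "bil y (x u) \<noteq> 0" if "u \<in> E" for u using that by (auto simp: E_def)
  \<comment> \<open>Two chart coordinates and three scalars match the dimension 5 of the target, as
    invariance of domain requires; \<open>r > 0\<close> keeps the image away from 0.\<close>
  define W where "W = E \<times> {0::real<..} \<times> (UNIV :: (real \<times> real) set)"
  define \<Phi> where "\<Phi> = (\<lambda>(u, r, s, t). r *\<^sub>R x u + s *\<^sub>R m + t *\<^sub>R y)"
  \<comment> \<open>These pairings recover in turn \<open>s\<close>, then
    \<open>r * bil y (x u)\<close>, then \<open>t\<close>. They give both the injectivity and the
    vanishing of \<open>s\<close> and \<open>t\<close> over the sphere.\<close>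
  have \<Phi>m: "bil m (\<Phi> (u, r, s, t)) = s * bil m m"
    and \<Phi>y: "bil y (\<Phi> (u, r, s, t)) = r * bil y (x u)"
    and \<Phi>\<Phi>: "bil (\<Phi> (u, r, s, t)) (\<Phi> (u, r, s, t)) = s * s * bil m m + 2 * (r * t * bil y (x u))"
    if "u \<in> E" for u r s t
    using ED[OF that] m(2)[of u] y null[of u] bil_commute[of m y] bil_commute[of "x u" m] bil_commute[of "x u" y]
    by (simp_all add: \<Phi>_def bil_simps algebra_simps)
  have "open (\<Phi> ` W)"
  proof (rule invariance_of_domain_gen)
    show "open W" unfolding W_def by (intro open_Times E open_greaterThan open_UNIV)
    have "continuous_on W (\<lambda>w. x (fst w))"
      by (rule continuous_on_compose2[OF continuous_on_subset[OF x(1)] continuous_on_fst[OF continuous_on_id]])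
        (auto simp: W_def E_def)
    then show "continuous_on W \<Phi>"
      unfolding \<Phi>_def case_prod_unfold by (intro continuous_intros)
    show "inj_on \<Phi> W"
    proof (rule inj_onI, clarsimp simp: W_def)
      fix u r s t u' r' s' t'
      assume u: "u \<in> E" "u' \<in> E" and r: "0 < r" "0 < r'" and eq: "\<Phi> (u, r, s, t) = \<Phi> (u', r', s', t')"
      have s: "s = s'" using \<Phi>m[OF u(1), of r s t] \<Phi>m[OF u(2), of r' s' t'] m(1) eq by simp
      have ry: "r * bil y (x u) = r' * bil y (x u')" using \<Phi>y[OF u(1), of r s t] \<Phi>y[OF u(2), of r' s' t'] eq by simp
      have "r * t * bil y (x u) = r' * t' * bil y (x u')"
        using \<Phi>\<Phi>[OF u(1), of r s t] \<Phi>\<Phi>[OF u(2), of r' s' t'] eq s by simp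
      then have "t * (r * bil y (x u)) = t' * (r' * bil y (x u'))" by (simp add: ac_simps)
      then have "t * (r * bil y (x u)) = t' * (r * bil y (x u))" by (simp only: ry)
      then have t: "t = t'" using r ED(2)[OF u(1)] by simp
      have rx: "r *\<^sub>R x u = r' *\<^sub>R x u'" using eq s t by (simp add: \<Phi>_def)
      then have "ppoint (x u) = ppoint (x u')" using ppoint_scale[of r "x u"] ppoint_scale[of r' "x u'"] r by simp
      then have "u = u'" using inj ED u by (auto simp: inj_on_def)
      then show "u = u' \<and> r = r' \<and> s = s' \<and> t = t'" using s t rx x(2)[OF ED(1)[OF u(2)]] by simp
    qed
  qed simp
  moreover have "0 \<notin> \<Phi> ` W"
  proof
    assume "0 \<in> \<Phi> ` W"
    then obtain u r s t where "u \<in> E" "r > 0" "\<Phi> (u, r, s, t) = 0" by (auto simp: W_def)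
    then show False using \<Phi>y[of u r s t] ED(2)[of u] by (simp add: bil_simps)
  qed
  ultimately have "openin PV_top (ppoint ` \<Phi> ` W)" by (rule openin_ppoint_image)
  moreover have "ppoint (x u0) \<in> ppoint ` \<Phi> ` W"
  proof -
    have "(u0, 1, 0, 0) \<in> W" "\<Phi> (u0, 1, 0, 0) = x u0"
      using u0 y(3) by (simp_all add: W_def E_def \<Phi>_def)
    then show ?thesis by (metis imageI)
  qed
  moreover have "ppoint ` \<Phi> ` W \<inter> sphere_of m \<subseteq> (ppoint \<circ> x) ` D"
  proof
    fix q assume q: "q \<in> ppoint ` \<Phi> ` W \<inter> sphere_of m"
    then obtain u r s t where u: "u \<in> E" "r > 0" and qe: "q = ppoint (\<Phi> (u, r, s, t))"
      by (auto simp: W_def)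
    have "\<Phi> (u, r, s, t) \<noteq> 0" using \<Phi>y[OF u(1), of r s t] u ED(2)[of u] by (auto simp: bil_simps)
    then have "bil m (\<Phi> (u, r, s, t)) = 0" "bil (\<Phi> (u, r, s, t)) (\<Phi> (u, r, s, t)) = 0"
      using q qe ppoint_in_sphere_of by auto
    then have "s = 0" "t = 0" using \<Phi>m[OF u(1), of r s t] \<Phi>\<Phi>[OF u(1), of r s t] m(1) u ED(2)[OF u(1)] by auto
    then have "q = ppoint (x u)" using qe u ppoint_scale[of r "x u"] by (simp add: \<Phi>_def)
    then show "q \<in> (ppoint \<circ> x) ` D" using ED(1)[OF u(1)] by auto
  qed
  ultimately show ?thesis by blast
qed

section \<open>From local spheres to a single sphere\<close>

lemma two_isotropic_spherical_chart:
  assumes M: "M \<subseteq> quadric" "hyperbolic M" "two_isotropic M" and p: "p \<in> M"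
  obtains E x m where "local_param M E x" "p \<in> (ppoint \<circ> x) ` E" "bil m m < 0"
    "(ppoint \<circ> x) ` E \<subseteq> sphere_of m"
proof -
  obtain D x N1 N2 n where x: "local_param M D x" and pD: "p \<in> (ppoint \<circ> x) ` D"
    and N: "null_frame D x N1 N2" and n: "normal_field D x n"
    and "\<forall>u\<in>D. ell x N1 n u = 0 \<and> ell x N2 n u = 0"
    using bspec[OF M(3)[unfolded two_isotropic_def] p] by (elim exE conjE)
  then have ell: "ell x N1 n u = 0" "ell x N2 n u = 0" if "u \<in> D" for u
    using that by auto
  obtain u0 where u0: "u0 \<in> D" "p = ppoint (x u0)" using pD by auto
  have null: "bil (x u) (x u) = 0" if "u \<in> D" for u
    using local_param_null[OF x M(1) that] .
  have card: "card (null_lines x u) = 2" if "u \<in> D" for u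
    using M(2) x that by (auto simp: hyperbolic_def)
  have g: "induced_form x u (N1 u) (N2 u) \<noteq> 0" if "u \<in> D" for u
    using null_lines_frame[OF smooth_on_linear_derivative[OF local_paramD(2)[OF x] that] card[OF that]]
      N that by (auto simp: null_frame_def)
  obtain e m where e: "e > 0" "ball u0 e \<subseteq> D" "bil m m = -2"
    "\<And>u. u \<in> ball u0 e \<Longrightarrow> bil m (x u) = 0"
    using two_isotropic_locally_spherical[OF local_paramD(1,2,3,4)[OF x] null N g n ell u0(1)] by blast
  show thesis
  proof
    show "local_param M (ball u0 e) x" by (rule local_param_subset[OF x open_ball e(2)])
    show "p \<in> (ppoint \<circ> x) ` ball u0 e" using u0 e(1) by auto
    show "bil m m < 0" using e(3) by simp
    show "(ppoint \<circ> x) ` ball u0 e \<subseteq> sphere_of m"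
    proof
      fix q assume "q \<in> (ppoint \<circ> x) ` ball u0 e"
      then obtain u where u: "u \<in> ball u0 e" "q = ppoint (x u)" by auto
      then have "u \<in> D" using e(2) by blast
      then show "q \<in> sphere_of m"
        using u e(4) null by (simp add: ppoint_in_sphere_of[OF local_paramD(3)[OF x]])
    qed
  qed
qed

lemma spherical_chart_orthogonal:
  assumes "local_param M E x" "(ppoint \<circ> x) ` E \<subseteq> sphere_of m" "u \<in> E"
  shows "bil m (x u) = 0" "bil (x u) (x u) = 0"
proof -
  have "ppoint (x u) \<in> sphere_of m" using assms(2,3) by auto
  then show "bil m (x u) = 0" "bil (x u) (x u) = 0"
    using ppoint_in_sphere_of[OF local_paramD(3)[OF assms(1,3)]] by auto
qed

lemma two_isotropic_subset_sphere:
  assumes M: "M \<subseteq> quadric" "hyperbolic M" "two_isotropic M" and conn: "connectedin PV_top M"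
  shows "\<exists>m. bil m m < 0 \<and> M \<subseteq> sphere_of m"
proof (cases "M = {}")
  case True
  \<comment> \<open>The empty set counts as connected, and any indefinite sphere contains
    it.\<close>
  have "bil (axis 2 1) (axis 2 1) < 0" by (simp add: bil_def axis_def)
  with True show ?thesis by blast
next
  case False
  then obtain p0 where p0: "p0 \<in> M" by blast
  obtain E0 x0 m0 where 0: "local_param M E0 x0" "p0 \<in> (ppoint \<circ> x0) ` E0" "bil m0 m0 < 0"
    "(ppoint \<circ> x0) ` E0 \<subseteq> sphere_of m0"
    by (rule two_isotropic_spherical_chart[OF M p0])
  let ?T = "subtopology PV_top M"
  \<comment> \<open>\<open>U\<close> is the largest relatively open subset of \<open>M\<close>
    inside the first sphere, and \<open>V\<close> the largest one disjoint from \<open>U\<close>.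
    Once they cover \<open>M\<close>, connectedness gives \<open>V = {}\<close>.\<close>
  define U where "U = \<Union>{O'. openin ?T O' \<and> O' \<subseteq> sphere_of m0}"
  define V where "V = \<Union>{O'. openin ?T O' \<and> O' \<inter> U = {}}"
  have U: "openin ?T U" and V: "openin ?T V" unfolding U_def V_def by (rule openin_Union; blast)+
  have "p0 \<in> U" using local_paramD(5)[OF 0(1)] 0(2,4) unfolding U_def by blast
  have "q \<in> U \<union> V" if "q \<in> M" for q
  proof -
    obtain E x m where E: "local_param M E x" "q \<in> (ppoint \<circ> x) ` E" "bil m m < 0"
      "(ppoint \<circ> x) ` E \<subseteq> sphere_of m"
      by (rule two_isotropic_spherical_chart[OF M \<open>q \<in> M\<close>])
    show ?thesis
    proof (cases "(ppoint \<circ> x) ` E \<inter> U = {}")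
      case True
      then show ?thesis using local_paramD(5)[OF E(1)] E(2) unfolding V_def by blast
    next
      case False
      then obtain O' where O': "openin ?T O'" "O' \<subseteq> sphere_of m0" "(ppoint \<circ> x) ` E \<inter> O' \<noteq> {}"
        unfolding U_def by blast
      \<comment> \<open>On \<open>F\<close> the chart lies in both spheres, so
        \<open>sphere_of_unique\<close> identifies them. The whole chart then lies in the first
        sphere, hence in \<open>U\<close>.\<close>
      define F where "F = {u \<in> E. ppoint (x u) \<in> O'}"
      have F: "open F" "F \<noteq> {}" "F \<subseteq> E"
        using local_param_open_vimage[OF E(1) O'(1)] O'(3) by (auto simp: F_def)
      have xF: "local_param M F x" by (rule local_param_subset[OF E(1) F(1,3)])
      have F0: "(ppoint \<circ> x) ` F \<subseteq> sphere_of m0" using O'(2) by (auto simp: F_def)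
      have Fm: "(ppoint \<circ> x) ` F \<subseteq> sphere_of m" using E(4) F(3) by blast
      have "card (null_lines x u) = 2" if "u \<in> F" for u
        using M(2) xF that by (auto simp: hyperbolic_def)
      from sphere_of_unique[OF F(1,2) local_paramD(2,3)[OF xF] local_param_inj[OF xF]
          spherical_chart_orthogonal(2)[OF xF Fm] this E(3) spherical_chart_orthogonal(1)[OF xF Fm]
          0(3) spherical_chart_orthogonal(1)[OF xF F0]]
      have "(ppoint \<circ> x) ` E \<subseteq> sphere_of m0" using E(4) by simp
      then show ?thesis using local_paramD(5)[OF E(1)] E(2) unfolding U_def by blast
    qed
  qed
  then have "topspace ?T \<subseteq> U \<union> V" by auto
  moreover have "U \<inter> V = {}" by (auto simp: V_def)
  moreover have "U \<noteq> {}" using \<open>p0 \<in> U\<close> by blast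
  ultimately have "V = {}"
    using conn U V unfolding connectedin_def connected_space_def by blast
  then have "M \<subseteq> U" using \<open>\<And>q. q \<in> M \<Longrightarrow> q \<in> U \<union> V\<close> by blast
  then have "M \<subseteq> sphere_of m0" unfolding U_def by blast
  with 0(3) show ?thesis by blast
qed

text \<open>Around each point, \<open>parametrized_open_in_sphere\<close> gives a neighbourhood in
  the sphere covered by a chart, and chart images lie in \<open>M\<close>.\<close>

lemma surface_open_in_sphere:
  assumes M: "surface M" and m: "bil m m < 0" "M \<subseteq> sphere_of m"
  shows "openin (subtopology PV_top (sphere_of m)) M"
proof (subst openin_subopen, rule ballI)
  fix p assume p: "p \<in> M"
  obtain D x where x: "local_param M D x" "p \<in> (ppoint \<circ> x) ` D"
    using M p by (auto simp: surface_def)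
  then obtain u0 where u0: "u0 \<in> D" "p = ppoint (x u0)" by auto
  have Dm: "(ppoint \<circ> x) ` D \<subseteq> sphere_of m" using local_param_image_subset[OF x(1)] m(2) by blast
  obtain T where T: "openin PV_top T" "ppoint (x u0) \<in> T" "T \<inter> sphere_of m \<subseteq> (ppoint \<circ> x) ` D"
    using parametrized_open_in_sphere[OF local_paramD(1)[OF x(1)] smooth_on_continuous[OF local_paramD(2)[OF x(1)]]
        local_paramD(3)[OF x(1)] local_param_inj[OF x(1)] spherical_chart_orthogonal(2)[OF x(1) Dm]
        m(1) spherical_chart_orthogonal(1)[OF x(1) Dm] u0(1)] by blast
  have "openin (subtopology PV_top (sphere_of m)) (T \<inter> sphere_of m)"
    using T(1) by (rule openin_subtopology_Int)
  moreover have "p \<in> T \<inter> sphere_of m" using T(2) u0(2) p m(2) by blast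
  moreover have "T \<inter> sphere_of m \<subseteq> M" using T(3) local_param_image_subset[OF x(1)] by blast
  ultimately show "\<exists>T. openin (subtopology PV_top (sphere_of m)) T \<and> p \<in> T \<and> T \<subseteq> M" by blast
qed

section \<open>Null frames\<close>

lemma induced_form_expand:
  fixes x :: "real^2 \<Rightarrow> real^5"
  assumes lin: "linear (frechet_derivative x (at u))"
  defines "g \<equiv> induced_form x u" and "e \<equiv> axis 1 1" and "f \<equiv> axis 2 1"
  shows "g v w = v$1 * w$1 * g e e + (v$1 * w$2 + v$2 * w$1) * g e f + v$2 * w$2 * g f f"
  unfolding g_def induced_form_def linear_real2_expand[OF lin, of v] linear_real2_expand[OF lin, of w]
  by (simp add: bil_simps e_def f_def bil_commute[of "frechet_derivative x (at u) (axis 2 1)"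
        "frechet_derivative x (at u) (axis 1 1)"] algebra_simps)

text \<open>Minus the Gram determinant is multiplied by the squared determinant under a change of
  basis. For a null basis \<open>a\<close>, \<open>b\<close> it is the positive number
  \<open>g a b * g a b\<close>.\<close>

lemma null_lines_discriminant:
  fixes x :: "real^2 \<Rightarrow> real^5"
  assumes lin: "linear (frechet_derivative x (at u))" and card: "card (null_lines x u) = 2"
  defines "g \<equiv> induced_form x u" and "e \<equiv> axis 1 1" and "f \<equiv> axis 2 1"
  shows "g e f * g e f - g e e * g f f > 0"
proof -
  obtain a b where ab: "g a a = 0" "g b b = 0" "g a b \<noteq> 0"
    using null_lines_obtain_frame[OF lin card] unfolding g_def by blast
  note ex = induced_form_expand[OF lin, folded g_def e_def f_def]
  have "(a$1 * b$2 - a$2 * b$1)\<^sup>2 * (g e f * g e f - g e e * g f f) = g a b * g a b - g a a * g b b"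
    unfolding ex[of a b] ex[of a a] ex[of b b] by (simp add: power2_eq_square algebra_simps)
  also have "\<dots> > 0" using ab by (auto simp: zero_less_mult_iff)
  finally show ?thesis by (simp add: zero_less_mult_iff)
qed

lemma independent_real2:
  fixes a b :: "real^2"
  assumes "a$1 * b$2 - a$2 * b$1 \<noteq> 0"
  shows "independent {a, b}" "a \<noteq> b"
proof -
  show "a \<noteq> b" using assms by auto
  have "b \<noteq> 0" using assms by auto
  moreover have "a \<notin> span {b}" using assms by (auto simp: span_singleton)
  ultimately show "independent {a, b}" by (auto simp: independent_insert)
qed

text \<open>With \<open>E, F, G\<close> the coefficients of the form and \<open>q\<close> a root of \<open>q\<^sup>2 - 2 F q + E G\<close>, the vectors \<open>(-q, E)\<close> and
  \<open>(G, -q)\<close> are null, and independent where \<open>q \<noteq> 0\<close>. The sign of the square root is chosen so that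
  \<open>q\<close> does not vanish at \<open>u\<^sub>0\<close>.\<close>

lemma null_frame_exists:
  fixes x :: "real^2 \<Rightarrow> real^5"
  assumes D: "open D" and x: "smooth_on D x" and u0: "u0 \<in> D"
    and card: "\<And>u. u \<in> D \<Longrightarrow> card (null_lines x u) = 2"
  shows "\<exists>C N1 N2. open C \<and> u0 \<in> C \<and> C \<subseteq> D \<and> null_frame C x N1 N2"
proof -
  define e f :: "real^2" where "e = axis 1 1" and "f = axis 2 1"
  define E where "E u = induced_form x u e e" for u
  define F where "F u = induced_form x u e f" for u
  define G where "G u = induced_form x u f f" for u
  have s: "smooth_on D (\<lambda>u. induced_form x u v w)" for v w
    unfolding induced_form_def
    by (rule smooth_on_bilinear[OF bounded_bilinear_bil D smooth_on_derivative[OF x] smooth_on_derivative[OF x]])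
  have sE: "smooth_on D E" and sF: "smooth_on D F" and sG: "smooth_on D G"
    unfolding E_def F_def G_def by (rule s)+
  have lin: "linear (frechet_derivative x (at u))" if "u \<in> D" for u
    by (rule smooth_on_linear_derivative[OF x that])
  define d where "d u = F u * F u + - (E u * G u)" for u
  have d: "d u > 0" if "u \<in> D" for u
    using null_lines_discriminant[OF lin[OF that] card[OF that]]
    by (simp add: d_def E_def F_def G_def e_def f_def)
  have sd: "smooth_on D d"
    unfolding d_def
    by (rule smooth_on_add[OF D smooth_on_mult[OF D sF sF] smooth_on_minus[OF D smooth_on_mult[OF D sE sG]]])
  define \<sigma> :: real where "\<sigma> = (if F u0 \<ge> 0 then 1 else -1)"
  have \<sigma>: "\<sigma> * \<sigma> = 1" by (simp add: \<sigma>_def)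
  define q where "q u = F u + \<sigma> * sqrt (d u)" for u
  have sq: "smooth_on D q"
    unfolding q_def
    by (rule smooth_on_add[OF D sF smooth_on_mult[OF D smooth_on_const[OF D] smooth_on_sqrt[OF D d sd]]])
  have root: "q u * q u - 2 * F u * q u + E u * G u = 0" if "u \<in> D" for u
  proof -
    have "q u * q u - 2 * F u * q u = (\<sigma> * \<sigma>) * (sqrt (d u) * sqrt (d u)) - F u * F u"
      by (simp add: q_def algebra_simps)
    also have "\<dots> = d u - F u * F u" using d[OF that] \<sigma> by simp
    finally show ?thesis by (simp add: d_def)
  qed
  define C where "C = D \<inter> q -` (-{0})"
  have C: "open C" "C \<subseteq> D"
    using smooth_on_continuous[OF sq] D by (auto simp: C_def continuous_on_open_vimage[OF D] Int_commute open_Compl)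
  have "q u0 \<noteq> 0"
  proof (cases "F u0 \<ge> 0")
    case True
    then have "q u0 > 0" using d[OF u0] by (simp add: q_def \<sigma>_def add_nonneg_pos)
    then show ?thesis by simp
  next
    case False
    then have "q u0 < 0" using d[OF u0] by (simp add: q_def \<sigma>_def order.strict_trans[of "F u0" 0])
    then show ?thesis by simp
  qed
  then have "u0 \<in> C" using u0 by (simp add: C_def)
  \<comment> \<open>One vector uses \<open>E\<close> and the other \<open>G\<close>. Taking
    \<open>(-q, E)\<close> for both roots \<open>q\<close> would give dependent vectors where
    \<open>E\<close> vanishes.\<close>
  define N1 N2 :: "real^2 \<Rightarrow> real^2" where "N1 u = vector [- q u, E u]" and "N2 u = vector [G u, - q u]" for u
  have sub: "smooth_on C h" if "smooth_on D h" for h :: "real^2 \<Rightarrow> real" by (rule smooth_on_subset[OF that C(2)])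
  have "null_frame C x N1 N2"
    unfolding null_frame_def
  proof (intro conjI ballI)
    show "smooth_on C N1"
      unfolding N1_def by (rule smooth_on_real2_pair[OF C(1) smooth_on_minus[OF C(1) sub[OF sq]] sub[OF sE]])
    show "smooth_on C N2"
      unfolding N2_def by (rule smooth_on_real2_pair[OF C(1) sub[OF sG] smooth_on_minus[OF C(1) sub[OF sq]]])
    fix u assume u: "u \<in> C"
    then have uD: "u \<in> D" and qu: "q u \<noteq> 0" by (auto simp: C_def)
    have EG: "E u * G u = 2 * F u * q u - q u * q u" using root[OF uD] by simp
    \<comment> \<open>The left side is the determinant of \<open>N1\<close>, \<open>N2\<close>; by
      the quadratic equation it equals 2 q (q - F), nonzero since \<open>q\<close> and the
      discriminant are.\<close>
    have "q u * q u - E u * G u = 2 * q u * (\<sigma> * sqrt (d u))"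
      by (simp add: EG q_def algebra_simps)
    moreover have "\<sigma> * sqrt (d u) \<noteq> 0" using d[OF uD] \<sigma> by auto
    ultimately have det: "N1 u $ 1 * N2 u $ 2 - N1 u $ 2 * N2 u $ 1 \<noteq> 0"
      using qu by (simp add: N1_def N2_def)
    show "N1 u \<noteq> N2 u" "independent {N1 u, N2 u}" using independent_real2[OF det] by auto
    have ex: "induced_form x u v v = v$1 * v$1 * E u + 2 * (v$1 * v$2) * F u + v$2 * v$2 * G u" for v
      using induced_form_expand[OF lin[OF uD], of v v] by (simp add: E_def F_def G_def e_def f_def algebra_simps)
    have "induced_form x u (N1 u) (N1 u) = E u * (q u * q u - 2 * F u * q u + E u * G u)"
      unfolding ex by (simp add: N1_def algebra_simps)
    then show "induced_form x u (N1 u) (N1 u) = 0" using root[OF uD] by simp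
    have "induced_form x u (N2 u) (N2 u) = G u * (q u * q u - 2 * F u * q u + E u * G u)"
      unfolding ex by (simp add: N2_def algebra_simps)
    then show "induced_form x u (N2 u) (N2 u) = 0" using root[OF uD] by simp
  qed
  with C \<open>u0 \<in> C\<close> show ?thesis by blast
qed

section \<open>Surfaces in an indefinite sphere are 2-isotropic\<close>

text \<open>With a constant normal \<open>m\<close>, differentiating \<open>bil m x = 0\<close> once
  shows that \<open>m\<close> is normal. Differentiating \<open>bil m (along K x) = 0\<close> along
  \<open>K\<close> then gives \<open>ell = 0\<close> for every smooth \<open>K\<close>.\<close>

lemma subset_sphere_two_isotropic:
  assumes M: "surface M" "hyperbolic M" and z: "bil z z < 0" "M \<subseteq> sphere_of z"
  shows "two_isotropic M"
  unfolding two_isotropic_def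
proof
  fix p assume p: "p \<in> M"
  \<comment> \<open>This factor normalizes the pole to \<open>bil m m = -2\<close>; the radicand is
    positive because \<open>bil z z < 0\<close>.\<close>
  define k where "k = sqrt (2 / - bil z z)"
  define m where "m = k *\<^sub>R z"
  have "k * k = 2 / - bil z z" using z(1) by (simp add: k_def divide_nonneg_neg)
  then have mm: "bil m m = -2" using z(1) by (simp add: m_def bil_simps mult.assoc[symmetric])
  have "k \<noteq> 0" using z(1) by (simp add: k_def)
  then have Mm: "M \<subseteq> sphere_of m" using z(2) by (simp add: m_def sphere_of_scale)
  obtain D x where xD: "local_param M D x" "p \<in> (ppoint \<circ> x) ` D"
    using M(1) p by (auto simp: surface_def)
  then obtain u0 where u0: "u0 \<in> D" "p = ppoint (x u0)" by auto
  have "card (null_lines x u) = 2" if "u \<in> D" for u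
    using M(2) xD(1) that by (auto simp: hyperbolic_def)
  from null_frame_exists[OF local_paramD(1,2)[OF xD(1)] u0(1) this]
  obtain C N1 N2 where C: "open C" "u0 \<in> C" "C \<subseteq> D" and N: "null_frame C x N1 N2" by blast
  have xC: "local_param M C x" by (rule local_param_subset[OF xD(1) C(1,3)])
  note x = local_paramD(2)[OF xC]
  have Cm: "(ppoint \<circ> x) ` C \<subseteq> sphere_of m" using local_param_image_subset[OF xC] Mm by blast
  have d: "bil m (frechet_derivative h (at u) v) = 0"
    if "smooth_on C h" "\<And>u. u \<in> C \<Longrightarrow> bil m (h u) = 0" "u \<in> C" for h :: "real^2 \<Rightarrow> real^5" and u v
    using bil_const_derivative[OF C(1) that(3) smooth_on_const[OF C(1)] that(1,2), where v = v]
    by (simp add: bil_simps frechet_derivative_const)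
  have dx: "bil m (frechet_derivative x (at u) v) = 0" if "u \<in> C" for u v
    by (rule d[OF x spherical_chart_orthogonal(1)[OF xC Cm] that])
  have "ell x K (\<lambda>u. m) u = 0" if "smooth_on C K" "u \<in> C" for K u
  proof -
    have "bil m (along K x u) = 0" if "u \<in> C" for u using dx[OF that] by (simp add: along_def)
    from d[OF smooth_on_along[OF C(1) that(1) x] this that(2), of "K u"]
    show ?thesis by (simp add: ell_def along_def[of K "along K x"] bil_commute)
  qed
  moreover have "smooth_on C N1" "smooth_on C N2" using N by (auto simp: null_frame_def)
  moreover have "normal_field C x (\<lambda>u. m)"
    using smooth_on_const[OF C(1)] mm dx spherical_chart_orthogonal(1)[OF xC Cm]
    by (auto simp: normal_field_def)
  moreover have "p \<in> (ppoint \<circ> x) ` C" using u0(2) C(2) by auto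
  ultimately show "\<exists>D x N1 N2 n. local_param M D x \<and> p \<in> (ppoint \<circ> x) ` D \<and> null_frame D x N1 N2 \<and>
      normal_field D x n \<and> (\<forall>u\<in>D. ell x N1 n u = 0 \<and> ell x N2 n u = 0)"
    using xC N by blast
qed

section \<open>The equivalence for surfaces in the Lagrangian Grassmannian\<close>

theorem proposition4p4:
  fixes M :: "(real^4) set set"
  assumes "M \<subseteq> LG24"
    and "surface (plucker ` M)"
    and "connectedin PV_top (plucker ` M)"
    and "hyperbolic (plucker ` M)"
  shows "two_isotropic (plucker ` M) \<longleftrightarrow>
    (\<exists>S. indefinite_sphere S \<and> openin (subtopology PV_top S) (plucker ` M))"
proof
  assume "two_isotropic (plucker ` M)"
  moreover have "plucker ` M \<subseteq> quadric" using assms(2) by (simp add: surface_def)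
  ultimately obtain m where m: "bil m m < 0" "plucker ` M \<subseteq> sphere_of m"
    using two_isotropic_subset_sphere assms(3,4) by blast
  moreover from m(1) have "m \<noteq> 0" by (auto simp: bil_simps)
  ultimately show "\<exists>S. indefinite_sphere S \<and> openin (subtopology PV_top S) (plucker ` M)"
    using surface_open_in_sphere[OF assms(2) m] unfolding indefinite_sphere_def by blast
next
  assume "\<exists>S. indefinite_sphere S \<and> openin (subtopology PV_top S) (plucker ` M)"
  then obtain z where "bil z z < 0" "openin (subtopology PV_top (sphere_of z)) (plucker ` M)"
    by (auto simp: indefinite_sphere_def)
  then show "two_isotropic (plucker ` M)"
    using subset_sphere_two_isotropic[OF assms(2,4)] openin_imp_subset by blast
qed

end
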